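(* Let $n\ge 1$, let $w_n\ge\dots\ge w_1>0$ be real weights and let $B\in\{1,\dots,n\}$ with $w_1=w_B$. Consider the (1+1) EA (defined in the context) minimising the penalised fitness \[ f(x)=\sum_{i=1}^n w_i x_i+\max\{0,\,B-b(x)\}\cdot(n w_n+1),\qquad b(x)=\sum_{i=1}^n x_i . \] Then the expected optimisation time of the (1+1) EA is $O(n^2)$. Moreover, for every constant $c>0$, the optimisation time is $O(n^2\log n)$ with probability $1-O(n^{-c})$. The constants hidden in the $O$-notation do not depend on $n$, the weights, or $B$ (the second one may depend on $c$).
   Context: Problem: minimise $f_{\mathrm{obj}}(x)=\sum_{i=1}^n w_ix_i$ over $x\in\{0,1\}^n$ subject to the uniform constraint $x_1+\dots+x_n\ge B$. A search point is optimal if it satisfies the constraint and minimises $f_{\mathrm{obj}}$ among all points satisfying the constraint. (1+1) EA: choose $x_0$ uniformly at random from $\{0,1\}^n$; in each iteration create $x'$ by flipping each bit of $x_t$ independently with probability $1/n$; set $x_{t+1}=x'$ if $f(x')\le f(x_t)$, otherwise $x_{t+1}=x_t$. The optimisation time is the number of iterations until an optimal search point has been sampled for the first time. *)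

theory Defs
  imports "HOL-Probability.Probability"
begin

text \<open>Search points are bit strings of length n, represented as bool lists;
  bit i (1 \<le> i \<le> n) of xs is xs ! (i - 1).  Weights w i are indexed 1..n.\<close>

definition bval :: "bool \<Rightarrow> real" where
  "bval b = (if b then 1 else 0)"

definition ones :: "nat \<Rightarrow> bool list \<Rightarrow> real" where
  "ones n xs = (\<Sum>i=1..n. bval (xs ! (i - 1)))"

definition fobj :: "nat \<Rightarrow> (nat \<Rightarrow> real) \<Rightarrow> bool list \<Rightarrow> real" where
  "fobj n w xs = (\<Sum>i=1..n. w i * bval (xs ! (i - 1)))"

definition fpen :: "nat \<Rightarrow> (nat \<Rightarrow> real) \<Rightarrow> nat \<Rightarrow> bool list \<Rightarrow> real" where
  "fpen n w B xs = fobj n w xs + max 0 (real B - ones n xs) * (real n * w n + 1)"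

definition feasible :: "nat \<Rightarrow> nat \<Rightarrow> bool list \<Rightarrow> bool" where
  "feasible n B xs \<longleftrightarrow> length xs = n \<and> ones n xs \<ge> real B"

definition optimal :: "nat \<Rightarrow> (nat \<Rightarrow> real) \<Rightarrow> nat \<Rightarrow> bool list \<Rightarrow> bool" where
  "optimal n w B xs \<longleftrightarrow> feasible n B xs \<and>
     (\<forall>ys. feasible n B ys \<longrightarrow> fobj n w xs \<le> fobj n w ys)"

fun mutate :: "real \<Rightarrow> bool list \<Rightarrow> bool list pmf" where
  "mutate p [] = return_pmf []"
| "mutate p (b # bs) =
     bind_pmf (bernoulli_pmf p) (\<lambda>flip.
     bind_pmf (mutate p bs) (\<lambda>rest.
     return_pmf ((if flip then \<not> b else b) # rest)))"

definition ea_step :: "(bool list \<Rightarrow> real) \<Rightarrow> nat \<Rightarrow> bool list \<Rightarrow> bool list pmf" where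
  "ea_step f n x = map_pmf (\<lambda>y. if f y \<le> f x then y else x) (mutate (1 / real n) x)"

fun ea_traj :: "(bool list \<Rightarrow> real) \<Rightarrow> nat \<Rightarrow> nat \<Rightarrow> bool list list pmf" where
  "ea_traj f n 0 = map_pmf (\<lambda>x. [x]) (pmf_of_set {xs. length xs = n})"
| "ea_traj f n (Suc t) =
     bind_pmf (ea_traj f n t) (\<lambda>xs. map_pmf (\<lambda>y. xs @ [y]) (ea_step f n (last xs)))"

text \<open>Probability that the optimisation time T exceeds t, i.e. that none of
  x_0, ..., x_t is optimal, for the EA on the penalised fitness.\<close>
definition T_gt :: "nat \<Rightarrow> (nat \<Rightarrow> real) \<Rightarrow> nat \<Rightarrow> nat \<Rightarrow> real" where
  "T_gt n w B t = measure_pmf.prob (ea_traj (fpen n w B) n t)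
      {xs. \<forall>x \<in> set xs. \<not> optimal n w B x}"

text \<open>Expected optimisation time E[T] = sum_{t \<ge> 0} Pr[T > t] (T is nat-valued).\<close>
definition expected_T :: "nat \<Rightarrow> (nat \<Rightarrow> real) \<Rightarrow> nat \<Rightarrow> ennreal" where
  "expected_T n w B = (\<Sum>t. ennreal (T_gt n w B t))"

end

theory Submission
  imports Defs
begin

text \<open>A step from a search point with at least \<open>B\<close> one-bits is accepted only if it keeps that
  property and does not increase the objective. We use a Lyapunov function \<open>V\<close> with values in
  \<open>[0, C n\<^sup>2]\<close> that drops by at least 1 in expectation at every non-optimal point. This bounds the
  expected time by \<open>C n\<^sup>2\<close>; as \<open>V - 1 \<le> (1 - 1 / (C n\<^sup>2)) V\<close>, it also yields the exponential tail.

  For infeasible points the missing one-bits are counted with factor \<open>3 n\<close>. For feasible points,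
  \<open>V\<close> is a bounded concave function, essentially \<open>n\<^sup>2 (2 - 1 / G)\<close>, of a linear potential \<open>G\<close>
  that gives the bits not of minimal weight, and every surplus one-bit, a coefficient between 1 and a
  constant. The coefficients grow exponentially in the rank of the bit divided by \<open>n\<close>, capped so that
  they grow at most proportionally to the weights, times a slowly increasing factor. If there are
  surplus one-bits, deleting a one-bit gives drift of order \<open>G / n\<close>. Otherwise, with \<open>h\<close> bits of
  non-minimal weight set, at least \<open>h\<close> bits of minimal weight are unset, because the \<open>B\<close> lightest
  weights agree; swapping these gives drift of order \<open>h G / n\<^sup>2\<close>. In both cases it is at least of
  order \<open>G\<^sup>2 / n\<^sup>2\<close>. Accepted steps that replace one bit by several lighter ones raise \<open>G\<close>, but
  the growth of the coefficients makes swaps with lighter bits compensate for them.\<close>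

section \<open>Mutation as a random set of flipped bits\<close>

definition mutE :: "nat \<Rightarrow> real \<Rightarrow> (nat set \<Rightarrow> real) \<Rightarrow> real" where
  "mutE n p \<phi> = (\<Sum>S\<in>Pow {..<n}. p ^ card S * (1 - p) ^ (n - card S) * \<phi> S)"

definition flip :: "bool list \<Rightarrow> nat set \<Rightarrow> bool list" where
  "flip x S = map (\<lambda>i. (x ! i) \<noteq> (i \<in> S)) [0..<length x]"

lemma mutE_Suc:
  "mutE (Suc n) p \<phi> = p * mutE n p (\<lambda>S. \<phi> (insert 0 (Suc ` S))) + (1 - p) * mutE n p (\<lambda>S. \<phi> (Suc ` S))"
proof -
  let ?h = "\<lambda>S. p ^ card S * (1 - p) ^ (Suc n - card S) * \<phi> S"
  let ?A = "Pow (Suc ` {..<n})"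
  have P: "?A = (`) Suc ` Pow {..<n}" by (simp add: image_Pow_surj)
  have inj: "inj_on ((`) Suc) (Pow {..<n})" by (intro inj_onI) (simp add: inj_image_eq_iff)
  have inj2: "inj_on (insert 0) ?A"
  proof (rule inj_onI)
    fix S T assume "S \<in> ?A" "T \<in> ?A" "insert 0 S = insert 0 T"
    moreover have "0 \<notin> S" "0 \<notin> T" using calculation by auto
    ultimately show "S = T" by (metis Diff_insert_absorb)
  qed
  have "mutE (Suc n) p \<phi> = (\<Sum>S\<in>?A \<union> insert 0 ` ?A. ?h S)"
    unfolding mutE_def lessThan_Suc_eq_insert_0 Pow_insert by simp
  also have "\<dots> = (\<Sum>S\<in>?A. ?h S) + (\<Sum>S\<in>insert 0 ` ?A. ?h S)"
    by (rule sum.union_disjoint) auto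
  also have "(\<Sum>S\<in>insert 0 ` ?A. ?h S) = (\<Sum>S\<in>?A. ?h (insert 0 S))"
    using inj2 by (simp add: sum.reindex)
  also have "(\<Sum>S\<in>?A. ?h S) = (\<Sum>S\<in>Pow {..<n}. ?h (Suc ` S))"
    unfolding P using inj by (simp add: sum.reindex)
  also have "(\<Sum>S\<in>?A. ?h (insert 0 S)) = (\<Sum>S\<in>Pow {..<n}. ?h (insert 0 (Suc ` S)))"
    unfolding P using inj by (simp add: sum.reindex)
  also have "(\<Sum>S\<in>Pow {..<n}. ?h (Suc ` S)) = (1 - p) * mutE n p (\<lambda>S. \<phi> (Suc ` S))"
    unfolding mutE_def sum_distrib_left
  proof (rule sum.cong)
    fix S assume S: "S \<in> Pow {..<n}"
    then have "card S \<le> n" using card_mono[of "{..<n}" S] by simp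
    then show "?h (Suc ` S) = (1 - p) * (p ^ card S * (1 - p) ^ (n - card S) * \<phi> (Suc ` S))"
      by (simp add: card_image Suc_diff_le)
  qed simp
  also have "(\<Sum>S\<in>Pow {..<n}. ?h (insert 0 (Suc ` S))) = p * mutE n p (\<lambda>S. \<phi> (insert 0 (Suc ` S)))"
    unfolding mutE_def sum_distrib_left
  proof (rule sum.cong)
    fix S assume S: "S \<in> Pow {..<n}"
    then have "finite S" using finite_subset by blast
    then show "?h (insert 0 (Suc ` S)) = p * (p ^ card S * (1 - p) ^ (n - card S) * \<phi> (insert 0 (Suc ` S)))"
      by (simp add: card_image)
  qed simp
  finally show ?thesis by simp
qed

lemma finite_set_mutate: "finite (set_pmf (mutate p x))"
  by (induction x) auto

lemma set_mutate: "y \<in> set_pmf (mutate p x) \<Longrightarrow> length y = length x"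
  by (induction x arbitrary: y) auto

lemma flip_Cons:
  "flip (b # bs) (Suc ` S) = b # flip bs S"
  "flip (b # bs) (insert 0 (Suc ` S)) = (\<not> b) # flip bs S"
proof -
  have "[0..<Suc k] = 0 # map Suc [0..<k]" for k using upt_conv_Cons[of 0 "Suc k"] map_Suc_upt[of 0 k] by simp
  then show "flip (b # bs) (Suc ` S) = b # flip bs S" "flip (b # bs) (insert 0 (Suc ` S)) = (\<not> b) # flip bs S"
    by (simp_all add: flip_def del: upt_Suc) auto
qed

lemma expectation_mutate:
  assumes "0 \<le> p" "p \<le> 1"
  shows "measure_pmf.expectation (mutate p x) \<phi> = mutE (length x) p (\<lambda>S. \<phi> (flip x S))"
proof (induction x arbitrary: \<phi>)
  case Nil
  show ?case by (simp add: mutE_def flip_def)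
next
  case (Cons b bs)
  have "measure_pmf.expectation (mutate p (b # bs)) \<phi>
     = (\<Sum>a\<in>UNIV. pmf (bernoulli_pmf p) a *\<^sub>R
          measure_pmf.expectation (map_pmf (\<lambda>r. (if a then \<not> b else b) # r) (mutate p bs)) \<phi>)"
    unfolding mutate.simps map_pmf_def[symmetric]
    by (rule pmf_expectation_bind) (auto simp: finite_set_mutate)
  also have "\<dots> = p * measure_pmf.expectation (mutate p bs) (\<lambda>r. \<phi> ((\<not> b) # r))
      + (1 - p) * measure_pmf.expectation (mutate p bs) (\<lambda>r. \<phi> (b # r))"
    using assms by (simp add: UNIV_bool)
  also have "\<dots> = mutE (length (b # bs)) p (\<lambda>S. \<phi> (flip (b # bs) S))"
    unfolding Cons.IH by (simp add: mutE_Suc flip_Cons)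
  finally show ?case .
qed

lemma mutE_mono:
  assumes "0 \<le> p" "p \<le> 1" "\<And>S. S \<subseteq> {..<n} \<Longrightarrow> \<phi> S \<le> \<psi> S"
  shows "mutE n p \<phi> \<le> mutE n p \<psi>"
  unfolding mutE_def using assms by (intro sum_mono mult_left_mono) auto

lemma mutE_add: "mutE n p (\<lambda>S. \<phi> S + \<psi> S) = mutE n p \<phi> + mutE n p \<psi>"
  by (simp add: mutE_def sum.distrib algebra_simps)

lemma mutE_diff: "mutE n p (\<lambda>S. \<phi> S - \<psi> S) = mutE n p \<phi> - mutE n p \<psi>"
  by (simp add: mutE_def sum_subtractf algebra_simps)

lemma mutE_cmult: "mutE n p (\<lambda>S. c * \<phi> S) = c * mutE n p \<phi>"
  by (simp add: mutE_def sum_distrib_left algebra_simps)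

lemma mutE_sum: "mutE n p (\<lambda>S. \<Sum>i\<in>A. \<phi> i S) = (\<Sum>i\<in>A. mutE n p (\<phi> i))"
  unfolding mutE_def sum_distrib_left by (rule sum.swap)

lemma mutE_subset:
  assumes "T \<subseteq> {..<n}"
  shows "mutE n p (\<lambda>S. of_bool (T \<subseteq> S)) = p ^ card T"
proof -
  have fin: "finite T" using assms finite_subset by blast
  let ?g = "\<lambda>i. if i \<in> T then 0 else 1 - p"
  have "mutE n p (\<lambda>S. of_bool (T \<subseteq> S)) = (\<Sum>S\<in>Pow {..<n}. (\<Prod>i\<in>S. p) * (\<Prod>i\<in>{..<n} - S. ?g i))"
    unfolding mutE_def
  proof (rule sum.cong)
    fix S assume S: "S \<in> Pow {..<n}"
    then have fS: "finite S" using finite_subset by blast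
    show "p ^ card S * (1 - p) ^ (n - card S) * of_bool (T \<subseteq> S) = (\<Prod>i\<in>S. p) * (\<Prod>i\<in>{..<n} - S. ?g i)"
    proof (cases "T \<subseteq> S")
      case True
      then have "(\<Prod>i\<in>{..<n} - S. ?g i) = (\<Prod>i\<in>{..<n} - S. 1 - p)" by (intro prod.cong) auto
      also have "\<dots> = (1 - p) ^ (n - card S)" using S fS by (simp add: card_Diff_subset)
      finally show ?thesis using True by simp
    next
      case False
      then obtain i where "i \<in> T" "i \<notin> S" by auto
      then have "(\<Prod>i\<in>{..<n} - S. ?g i) = 0" using assms by (intro prod_zero) auto
      then show ?thesis using False by simp
    qed
  qed simp
  also have "\<dots> = (\<Prod>i<n. p + ?g i)" by (rule prod_add[symmetric]) simp
  also have "\<dots> = (\<Prod>i<n. if i \<in> T then p else 1)" by (rule prod.cong) auto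
  also have "\<dots> = (\<Prod>i\<in>{..<n} \<inter> T. p)" by (rule prod.inter_restrict[symmetric]) simp
  also have "{..<n} \<inter> T = T" using assms by auto
  finally show ?thesis by simp
qed

lemma mutE_const: "mutE n p (\<lambda>S. c) = c"
  using mutE_subset[of "{}" n p] mutE_cmult[of n p c "\<lambda>_. 1"] by simp

lemma mutE_eq:
  assumes "T \<subseteq> {..<n}"
  shows "mutE n p (\<lambda>S. of_bool (S = T)) = p ^ card T * (1 - p) ^ (n - card T)"
proof -
  have "mutE n p (\<lambda>S. of_bool (S = T)) = (\<Sum>S\<in>Pow {..<n}. if S = T then p ^ card T * (1 - p) ^ (n - card T) else 0)"
    unfolding mutE_def by (rule sum.cong) auto
  then show ?thesis using assms by (simp add: sum.delta)
qed

lemma one_third_le: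
  assumes "1 \<le> n" "n - 1 \<ge> k"
  shows "1/3 \<le> (1 - 1 / real n) ^ k"
proof (cases "n = 1")
  case True then show ?thesis using assms by simp
next
  case False
  then have n: "2 \<le> n" using assms by simp
  define d where "d = real (n - 1)"
  have d: "real n = d + 1" "0 < d" using n by (auto simp: d_def)
  have "(1 + 1 / d) ^ (n - 1) \<le> exp (1 / d) ^ (n - 1)"
    using exp_ge_add_one_self[of "1 / d"] d by (intro power_mono) auto
  also have "\<dots> = exp 1" using d by (simp flip: exp_of_nat_mult d_def)
  also have "\<dots> \<le> 3" by (rule exp_le)
  finally have le: "(1 + 1 / d) ^ (n - 1) \<le> 3" .
  have inv: "1 - 1 / real n = 1 / (1 + 1 / d)" using d by (simp add: field_simps)
  have "0 < (1 + 1 / d) ^ (n - 1)" using d by (intro zero_less_power add_pos_pos) auto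
  then have "1/3 \<le> 1 / (1 + 1 / d) ^ (n - 1)" using le by (intro divide_left_mono) auto
  also have "\<dots> = (1 - 1 / real n) ^ (n - 1)" unfolding inv by (simp add: power_one_over)
  also have "\<dots> \<le> (1 - 1 / real n) ^ k" using n assms by (intro power_decreasing) auto
  finally show ?thesis .
qed

lemma mutE_eq_singleton_ge:
  assumes "i < n"
  shows "1 / real n / 3 \<le> mutE n (1 / real n) (\<lambda>S. of_bool (S = {i}))"
proof -
  have "1 / real n * (1/3) \<le> 1 / real n * (1 - 1 / real n) ^ (n - 1)"
    using one_third_le[of n "n - 1"] assms by (intro mult_left_mono) auto
  then show ?thesis using mutE_eq[of "{i}" n "1 / real n"] assms by simp
qed

lemma mutE_eq_pair_ge:
  assumes "i < n" "j < n" "i \<noteq> j"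
  shows "(1 / real n)\<^sup>2 / 3 \<le> mutE n (1 / real n) (\<lambda>S. of_bool (S = {i, j}))"
proof -
  have "(1 / real n)\<^sup>2 * (1/3) \<le> (1 / real n)\<^sup>2 * (1 - 1 / real n) ^ (n - 2)"
    using one_third_le[of n "n - 2"] assms by (intro mult_left_mono) auto
  then show ?thesis using mutE_eq[of "{i, j}" n "1 / real n"] assms by (simp add: numeral_2_eq_2)
qed

lemma mutE_1: "i < n \<Longrightarrow> mutE n p (\<lambda>S. of_bool (i \<in> S)) = p"
  using mutE_subset[of "{i}" n p] by simp

lemma mutE_2: "i < n \<Longrightarrow> j < n \<Longrightarrow> i \<noteq> j \<Longrightarrow> mutE n p (\<lambda>S. of_bool (i \<in> S) * of_bool (j \<in> S)) = p\<^sup>2"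
  using mutE_subset[of "{i, j}" n p] by (simp add: of_bool_conj power2_eq_square)

lemma mutE_3: "i < n \<Longrightarrow> j < n \<Longrightarrow> k < n \<Longrightarrow> i \<noteq> j \<Longrightarrow> i \<noteq> k \<Longrightarrow> j \<noteq> k \<Longrightarrow>
    mutE n p (\<lambda>S. of_bool (i \<in> S) * of_bool (j \<in> S) * of_bool (k \<in> S)) = p ^ 3"
  using mutE_subset[of "{i, j, k}" n p] by (simp add: of_bool_conj mult.assoc power3_eq_cube)

section \<open>Run time from additive drift\<close>

definition alive :: "nat \<Rightarrow> (nat \<Rightarrow> real) \<Rightarrow> nat \<Rightarrow> bool list list set" where
  "alive n w B = {xs. \<forall>x\<in>set xs. \<not> optimal n w B x}"

lemma set_ea_step:
  assumes "y \<in> set_pmf (ea_step f n x)" shows "length y = length x"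
  using assms set_mutate by (auto simp: ea_step_def split: if_splits)

lemma finite_bits: "finite {xs :: bool list. length xs = n}"
  using finite_lists_length_eq[of "UNIV :: bool set" n] by simp

lemma bits_nonempty: "{xs :: bool list. length xs = n} \<noteq> {}"
  using length_replicate[of n True] by blast

lemma set_ea_traj: "xs \<in> set_pmf (ea_traj f n t) \<Longrightarrow> xs \<noteq> [] \<and> length (last xs) = n"
proof (induction t arbitrary: xs)
  case 0
  then show ?case by (auto simp: set_pmf_of_set[OF bits_nonempty finite_bits])
next
  case (Suc t)
  then show ?case by (auto dest!: set_ea_step)
qed

definition mass :: "nat \<Rightarrow> (nat \<Rightarrow> real) \<Rightarrow> nat \<Rightarrow> (bool list \<Rightarrow> ennreal) \<Rightarrow> nat \<Rightarrow> ennreal" where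
  "mass n w B V t = (\<integral>\<^sup>+xs. indicator (alive n w B) xs * V (last xs) \<partial>ea_traj (fpen n w B) n t)"

lemma T_gt_eq: "ennreal (T_gt n w B t) = mass n w B (\<lambda>_. 1) t"
  by (simp add: T_gt_def mass_def alive_def measure_pmf.emeasure_eq_measure)

lemma mass_Suc_le:
  assumes "\<And>x. length x = n \<Longrightarrow> \<not> optimal n w B x \<Longrightarrow>
      (\<integral>\<^sup>+y. V y \<partial>ea_step (fpen n w B) n x) + 1 \<le> V x"
  shows "mass n w B V (Suc t) + mass n w B (\<lambda>_. 1) t \<le> mass n w B V t"
proof -
  let ?D = "ea_traj (fpen n w B) n t" and ?A = "alive n w B"
  have "mass n w B V (Suc t) = (\<integral>\<^sup>+xs. \<integral>\<^sup>+y. indicator ?A (xs @ [y]) * V y \<partial>ea_step (fpen n w B) n (last xs) \<partial>?D)"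
    by (simp add: mass_def)
  also have "\<dots> \<le> (\<integral>\<^sup>+xs. indicator ?A xs * (\<integral>\<^sup>+y. V y \<partial>ea_step (fpen n w B) n (last xs)) \<partial>?D)"
  proof (rule nn_integral_mono)
    fix xs
    have "(\<integral>\<^sup>+y. indicator ?A (xs @ [y]) * V y \<partial>ea_step (fpen n w B) n (last xs))
       \<le> (\<integral>\<^sup>+y. indicator ?A xs * V y \<partial>ea_step (fpen n w B) n (last xs))"
      by (intro nn_integral_mono mult_right_mono) (auto simp: indicator_def alive_def)
    then show "(\<integral>\<^sup>+y. indicator ?A (xs @ [y]) * V y \<partial>ea_step (fpen n w B) n (last xs))
       \<le> indicator ?A xs * (\<integral>\<^sup>+y. V y \<partial>ea_step (fpen n w B) n (last xs))"
      by (simp add: nn_integral_cmult)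
  qed
  finally have "mass n w B V (Suc t) + mass n w B (\<lambda>_. 1) t \<le>
     (\<integral>\<^sup>+xs. indicator ?A xs * (\<integral>\<^sup>+y. V y \<partial>ea_step (fpen n w B) n (last xs)) \<partial>?D) + mass n w B (\<lambda>_. 1) t"
    by (rule add_right_mono)
  also have "\<dots> = (\<integral>\<^sup>+xs. indicator ?A xs * ((\<integral>\<^sup>+y. V y \<partial>ea_step (fpen n w B) n (last xs)) + 1) \<partial>?D)"
    unfolding mass_def by (subst nn_integral_add[symmetric]) (auto simp: distrib_left)
  also have "\<dots> \<le> mass n w B V t" unfolding mass_def
  proof (rule nn_integral_mono_AE, subst AE_measure_pmf_iff, rule ballI)
    fix xs assume "xs \<in> set_pmf ?D"
    then have xs: "xs \<noteq> []" "length (last xs) = n" using set_ea_traj by auto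
    show "indicator ?A xs * ((\<integral>\<^sup>+y. V y \<partial>ea_step (fpen n w B) n (last xs)) + 1) \<le> indicator ?A xs * V (last xs)"
    proof (cases "xs \<in> ?A")
      case True
      then have "\<not> optimal n w B (last xs)" using xs by (auto simp: alive_def)
      then show ?thesis using assms[OF xs(2)] True by simp
    qed simp
  qed
  finally show ?thesis .
qed

lemma mass_mono:
  assumes "\<And>x. length x = n \<Longrightarrow> \<not> optimal n w B x \<Longrightarrow> V x \<le> W x"
  shows "mass n w B V t \<le> mass n w B W t"
  unfolding mass_def
proof (rule nn_integral_mono_AE, subst AE_measure_pmf_iff, rule ballI)
  fix xs assume "xs \<in> set_pmf (ea_traj (fpen n w B) n t)"
  then have xs: "xs \<noteq> []" "length (last xs) = n" using set_ea_traj by auto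
  show "indicator (alive n w B) xs * V (last xs) \<le> indicator (alive n w B) xs * W (last xs)"
  proof (cases "xs \<in> alive n w B")
    case True
    then have "\<not> optimal n w B (last xs)" using xs by (auto simp: alive_def)
    then show ?thesis using assms[OF xs(2)] True by simp
  qed simp
qed

lemma mass_const: "mass n w B (\<lambda>_. c) t = c * ennreal (T_gt n w B t)"
  unfolding T_gt_eq by (simp add: mass_def nn_integral_cmult_indicator mult.commute)

lemma runtime_of_drift:
  fixes V :: "bool list \<Rightarrow> real"
  assumes V0: "\<And>x. length x = n \<Longrightarrow> 0 \<le> V x" and VM: "\<And>x. length x = n \<Longrightarrow> V x \<le> M"
    and M: "1 \<le> M"
    and drift: "\<And>x. length x = n \<Longrightarrow> \<not> optimal n w B x \<Longrightarrow>
      measure_pmf.expectation (ea_step (fpen n w B) n x) V \<le> V x - 1"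
  shows "expected_T n w B \<le> ennreal M" "T_gt n w B t \<le> M * exp (- real t / M)"
proof -
  let ?V = "\<lambda>x. ennreal (V x)"
  have step: "(\<integral>\<^sup>+y. ?V y \<partial>ea_step (fpen n w B) n x) + 1 \<le> ?V x \<and> 1 \<le> V x"
    if x: "length x = n" "\<not> optimal n w B x" for x
  proof -
    let ?D = "ea_step (fpen n w B) n x"
    have "set_pmf ?D \<subseteq> {y. length y = n}" using set_ea_step x by blast
    then have fin: "finite (set_pmf ?D)" using finite_bits finite_subset by blast
    have AE: "AE y in ?D. 0 \<le> V y" using V0 set_ea_step x by (subst AE_measure_pmf_iff) blast
    have "(\<integral>\<^sup>+y. ?V y \<partial>?D) = ennreal (measure_pmf.expectation ?D V)"
      by (rule nn_integral_eq_integral[OF integrable_measure_pmf_finite[OF fin] AE])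
    moreover have nn: "0 \<le> measure_pmf.expectation ?D V" by (rule integral_nonneg_AE[OF AE])
    moreover have "ennreal (measure_pmf.expectation ?D V) + 1 = ennreal (measure_pmf.expectation ?D V + 1)"
      using nn by (simp add: ennreal_plus[symmetric] flip: ennreal_1 del: ennreal_plus)
    moreover have "ennreal (measure_pmf.expectation ?D V + 1) \<le> ?V x"
      using drift[OF x] by (intro ennreal_leI) simp
    ultimately show ?thesis using drift[OF x] by (metis add.commute add_increasing2 diff_ge_0_iff_ge order_trans)
  qed
  define a where "a t = mass n w B ?V t" for t
  have a: "a (Suc t) + ennreal (T_gt n w B t) \<le> a t" for t
    unfolding a_def T_gt_eq using mass_Suc_le[of n w B ?V t] step by blast
  have T1: "T_gt n w B t \<le> 1" "0 \<le> T_gt n w B t" for t by (auto simp: T_gt_def)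
  have aM: "a t \<le> ennreal M * ennreal (T_gt n w B t)" for t
  proof -
    have "a t \<le> mass n w B (\<lambda>_. ennreal M) t"
      unfolding a_def by (rule mass_mono) (use VM in \<open>auto intro!: ennreal_leI\<close>)
    then show ?thesis by (simp add: mass_const)
  qed
  have Ta: "ennreal (T_gt n w B t) \<le> a t" for t
    unfolding T_gt_eq a_def
  proof (rule mass_mono)
    fix x assume "length x = n" "\<not> optimal n w B x"
    then show "1 \<le> ?V x" using step by (metis ennreal_1 ennreal_leI)
  qed
  have a0: "a 0 \<le> ennreal M"
    using aM[of 0] T1[of 0] M by (metis (no_types) ennreal_1 ennreal_leI mult.right_neutral mult_left_mono order_trans zero_le)
  have part: "(\<Sum>s<t. ennreal (T_gt n w B s)) + a t \<le> a 0" for t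
  proof (induction t)
    case (Suc t)
    have "(\<Sum>s<Suc t. ennreal (T_gt n w B s)) + a (Suc t) = (\<Sum>s<t. ennreal (T_gt n w B s)) + (a (Suc t) + ennreal (T_gt n w B t))"
      by (simp add: add_ac)
    also have "\<dots> \<le> (\<Sum>s<t. ennreal (T_gt n w B s)) + a t" by (rule add_left_mono[OF a])
    also have "\<dots> \<le> a 0" by (rule Suc)
    finally show ?case .
  qed simp
  have "(\<Sum>s<t. ennreal (T_gt n w B s)) \<le> ennreal M" for t
  proof -
    have "(\<Sum>s<t. ennreal (T_gt n w B s)) \<le> (\<Sum>s<t. ennreal (T_gt n w B s)) + a t" by simp
    then show ?thesis using part[of t] a0 by order
  qed
  then show "expected_T n w B \<le> ennreal M"
    unfolding expected_T_def by (intro suminf_le_const) auto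
  define r where "r t = enn2real (a t)" for t
  have "a t < top" for t
    by (rule le_less_trans[OF aM]) (simp add: ennreal_mult_less_top)
  then have ra: "a t = ennreal (r t)" for t by (simp add: r_def)
  have r0: "0 \<le> r t" for t by (simp add: r_def)
  have r1: "r (Suc t) + T_gt n w B t \<le> r t" for t
    using a[of t] r0[of t] r0[of "Suc t"] T1[of t] unfolding ra
    by (simp add: ennreal_plus[symmetric] del: ennreal_plus)
  have r2: "r t \<le> M * T_gt n w B t" for t
    using aM[of t] T1[of t] M unfolding ra by (simp add: ennreal_mult[symmetric])
  have r3: "T_gt n w B t \<le> r t" for t
    using Ta[of t] r0[of t] unfolding ra by simp
  have dec: "r (Suc t) \<le> (1 - 1 / M) * r t" for t
  proof -
    have "r t / M \<le> T_gt n w B t" using r2[of t] M by (simp add: field_simps)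
    then show ?thesis using r1[of t] by (simp add: algebra_simps)
  qed
  have "r t \<le> M * (1 - 1 / M) ^ t" for t
  proof (induction t)
    case 0
    have "M * T_gt n w B 0 \<le> M * 1" using T1[of 0] M by (intro mult_left_mono) auto
    then show ?case using r2[of 0] by simp
  next
    case (Suc t)
    have "r (Suc t) \<le> (1 - 1 / M) * (M * (1 - 1 / M) ^ t)"
      by (rule order_trans[OF dec mult_left_mono[OF Suc]]) (use M in simp)
    then show ?case by (simp add: mult_ac)
  qed
  also have "M * (1 - 1 / M) ^ t \<le> M * exp (- 1 / M) ^ t"
    using exp_ge_add_one_self[of "- 1 / M"] M by (intro mult_left_mono power_mono) auto
  also have "\<dots> = M * exp (- real t / M)" by (simp flip: exp_of_nat_mult)
  finally show "T_gt n w B t \<le> M * exp (- real t / M)" using r3[of t] by simp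
qed

section \<open>Coefficients of the potential\<close>

lemma sum_sq_half_le:
  fixes a :: "nat \<Rightarrow> real"
  assumes "finite D" "\<And>i. i \<in> D \<Longrightarrow> 0 \<le> a i"
  shows "(\<Sum>i\<in>D. a i)^2 / 2 \<le> (\<Sum>i\<in>D. \<Sum>j\<in>{j\<in>D. i \<le> j}. a i * a j)"
proof -
  have sw: "(\<Sum>i\<in>D. \<Sum>j\<in>{j\<in>D. i \<le> j}. a i * a j) = (\<Sum>i\<in>D. \<Sum>j\<in>{j\<in>D. j \<le> i}. a i * a j)"
    using sum.swap_restrict[OF assms(1) assms(1), of "\<lambda>i j. a i * a j" "\<lambda>i j. i \<le> j"]
    by (simp add: mult.commute)
  have "(\<Sum>i\<in>D. a i)^2 = (\<Sum>i\<in>D. \<Sum>j\<in>D. a i * a j)"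
    by (simp add: power2_eq_square sum_product)
  also have "\<dots> \<le> (\<Sum>i\<in>D. (\<Sum>j\<in>{j\<in>D. i \<le> j}. a i * a j) + (\<Sum>j\<in>{j\<in>D. j \<le> i}. a i * a j))"
  proof (rule sum_mono)
    fix i assume i: "i \<in> D"
    have "D = {j\<in>D. i \<le> j} \<union> {j\<in>D. j < i}" by auto
    then have "(\<Sum>j\<in>D. a i * a j) = (\<Sum>j\<in>{j\<in>D. i \<le> j} \<union> {j\<in>D. j < i}. a i * a j)" by simp
    also have "\<dots> = (\<Sum>j\<in>{j\<in>D. i \<le> j}. a i * a j) + (\<Sum>j\<in>{j\<in>D. j < i}. a i * a j)"
      by (rule sum.union_disjoint) (use assms in auto)
    also have "(\<Sum>j\<in>{j\<in>D. j < i}. a i * a j) \<le> (\<Sum>j\<in>{j\<in>D. j \<le> i}. a i * a j)"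
      by (rule sum_mono2) (use assms i in auto)
    finally show "(\<Sum>j\<in>D. a i * a j) \<le> (\<Sum>j\<in>{j\<in>D. i \<le> j}. a i * a j) + (\<Sum>j\<in>{j\<in>D. j \<le> i}. a i * a j)"
      by simp
  qed
  also have "\<dots> = 2 * (\<Sum>i\<in>D. \<Sum>j\<in>{j\<in>D. i \<le> j}. a i * a j)"
    by (simp add: sum.distrib sw)
  finally show ?thesis by simp
qed

definition coeff_bound :: real where "coeff_bound = 4608 * exp 27648"

text \<open>Bit \<open>i\<close> has weight \<open>m + v i\<close>; \<open>m\<close> is the common weight of the \<open>B\<close> lightest bits.\<close>

locale weights =
  fixes n :: nat and v :: "nat \<Rightarrow> real" and m :: real and B :: nat
  assumes n_pos: "1 \<le> n" and m_pos: "0 < m"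
    and v_mono: "\<And>i j. i \<le> j \<Longrightarrow> j < n \<Longrightarrow> v i \<le> v j"
    and v_light: "\<And>i. i < B \<Longrightarrow> v i = 0"
    and B_pos: "1 \<le> B" and B_le: "B \<le> n"
begin

text \<open>A step changes the objective by the change of \<open>\<Sum>v i\<close> plus \<open>m\<close> times the change of the number
  of one-bits. So a surplus one-bit acts as an additional item of value \<open>m\<close>, and \<open>U\<close> collects
  all positive item values. \<open>gW\<close> is the largest function below \<open>\<gamma>\<close> on \<open>U\<close> for which
  \<open>gW a / a\<close> is decreasing, \<open>Lv a\<close> is the place where the minimum is attained, and the small
  slope \<open>sl\<close> rewards swaps between items of almost equal value, on which \<open>gW\<close> is nearly constant.
  The constants are \<open>\<delta> = 1/24\<close> (slope), \<open>\<alpha> = 27648\<close> (growth of \<open>\<gamma>\<close>) and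
  \<open>A = 2304\<close> (jump of \<open>\<gamma>\<close> above \<open>m\<close>); what matters is that \<open>\<delta>\<close> is small and
  that \<open>\<alpha>\<delta>\<close> and \<open>A\<delta>\<close> are large.\<close>

definition rk :: "real \<Rightarrow> nat" where "rk a = card {i. i < n \<and> v i < a}"
definition q :: real where "q = 1 + 27648 / real n"
definition \<gamma> :: "real \<Rightarrow> real" where "\<gamma> a = (if a > m then 2304 else 1) * q ^ rk a"
definition U :: "real set" where "U = insert m (v ` {i. i < n \<and> v i > 0})"
definition gW :: "real \<Rightarrow> real" where
  "gW a = (if a \<le> 0 then 0 else Min ((\<lambda>u. \<gamma> u * a / u) ` {u\<in>U. u \<le> a}))"
definition Lv :: "real \<Rightarrow> real" where
  "Lv a = (SOME u. u \<in> U \<and> u \<le> a \<and> gW a = \<gamma> u * a / u)"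
definition sl :: "real \<Rightarrow> real" where "sl a = 1 + real (rk a) / (24 * real n)"
definition g :: "real \<Rightarrow> real" where "g a = gW a * sl a"

lemma v_nonneg: "i < n \<Longrightarrow> 0 \<le> v i"
  using v_mono[of 0 i] v_light[of 0] B_pos by auto

lemma q_ge1: "1 \<le> q" using n_pos by (simp add: q_def)

lemma rk_mono: "a \<le> b \<Longrightarrow> rk a \<le> rk b"
  unfolding rk_def by (rule card_mono) auto

lemma rk_le: "rk a \<le> n"
proof -
  have "card {i. i < n \<and> v i < a} \<le> card {..<n}" by (rule card_mono) auto
  then show ?thesis by (simp add: rk_def)
qed

lemma rk_segment: "{i. i < n \<and> v i < a} = {..<rk a}"
proof (cases "\<exists>i<n. a \<le> v i")
  case True
  define k where "k = (LEAST i. i < n \<and> a \<le> v i)"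
  have k: "k < n" "a \<le> v k" using LeastI_ex[OF True] by (auto simp: k_def)
  have l: "v i < a" if "i < k" for i
    using not_less_Least[of i "\<lambda>i. i < n \<and> a \<le> v i"] that k by (auto simp: k_def)
  have "{i. i < n \<and> v i < a} = {..<k}"
  proof (intro set_eqI iffI)
    fix i assume "i \<in> {i. i < n \<and> v i < a}"
    then have "i < n" "v i < a" by auto
    then show "i \<in> {..<k}" using v_mono[of k i] k by (cases "k \<le> i") auto
  next
    fix i assume "i \<in> {..<k}"
    then show "i \<in> {i. i < n \<and> v i < a}" using l k by auto
  qed
  then show ?thesis by (simp add: rk_def)
next
  case False
  then have "{i. i < n \<and> v i < a} = {..<n}" by (auto simp: not_le)
  then show ?thesis by (simp add: rk_def)
qed

lemma less_rk_iff: "i < rk a \<longleftrightarrow> i < n \<and> v i < a"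
  using rk_segment[of a] by auto

lemma rk_v_le: "i < n \<Longrightarrow> rk (v i) \<le> i"
  using less_rk_iff[of i "v i"] by auto

lemma U_pos: "u \<in> U \<Longrightarrow> 0 < u" using m_pos by (auto simp: U_def)
lemma U_finite: "finite U" by (simp add: U_def)
lemma m_U: "m \<in> U" by (simp add: U_def)
lemma v_U: "i < n \<Longrightarrow> 0 < v i \<Longrightarrow> v i \<in> U" by (auto simp: U_def)

lemma \<gamma>_pos: "0 < \<gamma> a" using q_ge1 by (auto simp: \<gamma>_def)
lemma \<gamma>_mono: "a \<le> b \<Longrightarrow> \<gamma> a \<le> \<gamma> b"
  unfolding \<gamma>_def using power_increasing[OF rk_mono[of a b] q_ge1] q_ge1
  by (intro mult_mono) auto
lemma \<gamma>_ge1: "1 \<le> \<gamma> a"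
  using one_le_power[OF q_ge1, of "rk a"] by (auto simp: \<gamma>_def)

lemma q_power_le: "q ^ rk a \<le> exp 27648"
proof -
  have "q ^ rk a \<le> q ^ n" by (rule power_increasing[OF rk_le q_ge1])
  also have "\<dots> \<le> exp (27648 / real n) ^ n"
    using exp_ge_add_one_self[of "27648 / real n"] q_ge1 by (intro power_mono) (auto simp: q_def)
  also have "\<dots> = exp 27648" using n_pos by (simp flip: exp_of_nat_mult)
  finally show ?thesis .
qed

lemma Lv:
  assumes "a \<in> U"
  shows "Lv a \<in> U" "Lv a \<le> a" "gW a = \<gamma> (Lv a) * a / Lv a"
proof -
  have "gW a \<in> (\<lambda>u. \<gamma> u * a / u) ` {u\<in>U. u \<le> a}"
    using assms U_pos[OF assms] U_finite unfolding gW_def by (auto intro!: Min_in simp: not_le)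
  then have "\<exists>u. u \<in> U \<and> u \<le> a \<and> gW a = \<gamma> u * a / u" by auto
  from someI_ex[OF this] show "Lv a \<in> U" "Lv a \<le> a" "gW a = \<gamma> (Lv a) * a / Lv a"
    by (auto simp: Lv_def)
qed

lemma gW_le: "u \<in> U \<Longrightarrow> u \<le> a \<Longrightarrow> gW a \<le> \<gamma> u * a / u"
  using U_finite U_pos[of u] by (auto simp: gW_def intro!: Min_le)

lemma gW_le_ratio: "a \<in> U \<Longrightarrow> Lv a \<le> b \<Longrightarrow> gW b \<le> \<gamma> (Lv a) / Lv a * b"
  using gW_le[OF Lv(1), of a b] by simp

lemma gW_nonpos: "a \<le> 0 \<Longrightarrow> gW a = 0" by (simp add: gW_def)

lemma gW_ge_ratio:
  assumes "a \<in> U" "b \<in> U \<or> b = 0" "b \<le> a"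
  shows "\<gamma> (Lv a) / Lv a * b \<le> gW b"
proof (cases "b = 0")
  case False
  then have b: "b \<in> U" using assms by auto
  note L = Lv[OF b]
  have "gW a \<le> \<gamma> (Lv b) * a / Lv b" using gW_le[of "Lv b" a] L assms by auto
  then have "\<gamma> (Lv a) / Lv a * a \<le> \<gamma> (Lv b) / Lv b * a" using Lv[OF assms(1)] by simp
  then have "\<gamma> (Lv a) / Lv a \<le> \<gamma> (Lv b) / Lv b"
    using U_pos[OF assms(1)] mult_le_cancel_right_pos by blast
  then have "\<gamma> (Lv a) / Lv a * b \<le> \<gamma> (Lv b) / Lv b * b"
    using U_pos[OF b] by (intro mult_right_mono) auto
  then show ?thesis using L by simp
qed (simp add: gW_nonpos)

lemma \<gamma>_Lv_le: assumes "a \<in> U" shows "\<gamma> (Lv a) \<le> gW a"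
proof -
  have "1 \<le> a / Lv a" using U_pos[OF Lv(1)[OF assms]] Lv(2)[OF assms] by (simp add: field_simps)
  then have "\<gamma> (Lv a) * 1 \<le> \<gamma> (Lv a) * (a / Lv a)"
    using \<gamma>_pos[of "Lv a"] by (intro mult_left_mono) auto
  then show ?thesis using Lv(3)[OF assms] by simp
qed

lemma gW_le_\<gamma>: "a \<in> U \<Longrightarrow> gW a \<le> \<gamma> a"
  using gW_le[of a a] U_pos[of a] by simp

lemma gW_ge1: "a \<in> U \<Longrightarrow> 1 \<le> gW a"
  using \<gamma>_Lv_le[of a] \<gamma>_ge1[of "Lv a"] by linarith

lemma gW_mono:
  assumes "a \<in> U" "b \<in> U \<or> b = 0" "b \<le> a"
  shows "gW b \<le> gW a"
proof (cases "b = 0")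
  case True then show ?thesis using gW_ge1[OF assms(1)] by (simp add: gW_nonpos)
next
  case False
  then have b: "b \<in> U" using assms by auto
  show ?thesis
  proof (cases "Lv a \<le> b")
    case True
    have "gW b \<le> \<gamma> (Lv a) / Lv a * b" using gW_le_ratio[OF assms(1) True] .
    also have "\<dots> \<le> \<gamma> (Lv a) / Lv a * a"
      using \<gamma>_pos[of "Lv a"] U_pos[OF Lv(1)[OF assms(1)]] assms by (intro mult_left_mono) auto
    finally show ?thesis using Lv(3)[OF assms(1)] by simp
  next
    case False
    then have "\<gamma> b \<le> \<gamma> (Lv a)" by (intro \<gamma>_mono) auto
    then show ?thesis using gW_le_\<gamma>[OF b] \<gamma>_Lv_le[OF assms(1)] by linarith
  qed
qed

lemma sl_ge1: "1 \<le> sl a" by (simp add: sl_def)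
lemma sl_le: "sl a \<le> 25/24"
  using rk_le[of a] n_pos by (simp add: sl_def field_simps)
lemma sl_mono: "a \<le> b \<Longrightarrow> sl a \<le> sl b"
  using rk_mono[of a b] n_pos by (simp add: sl_def divide_right_mono)

lemma v_cases: "i < n \<Longrightarrow> v i \<in> U \<or> v i = 0"
  using v_nonneg[of i] v_U[of i] by fastforce

lemma gW_nonneg: "a \<in> U \<or> a = 0 \<Longrightarrow> 0 \<le> gW a"
  using gW_ge1[of a] by (auto simp: gW_nonpos)

lemma g_nonneg: "a \<in> U \<or> a = 0 \<Longrightarrow> 0 \<le> g a"
  using gW_nonneg[of a] sl_ge1[of a] by (simp add: g_def)
lemma gW_le_g: "a \<in> U \<or> a = 0 \<Longrightarrow> gW a \<le> g a"
  using mult_left_mono[OF sl_ge1[of a] gW_nonneg[of a]] by (simp add: g_def)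
lemma g_le_gW: "a \<in> U \<or> a = 0 \<Longrightarrow> g a \<le> 25/24 * gW a"
  using mult_left_mono[OF sl_le[of a] gW_nonneg[of a]] by (simp add: g_def)
lemma g_ge1: "a \<in> U \<Longrightarrow> 1 \<le> g a" using gW_ge1[of a] gW_le_g[of a] by simp
lemma g_zero: "g 0 = 0" by (simp add: g_def gW_nonpos)
lemma g_mono: "a \<in> U \<Longrightarrow> b \<in> U \<or> b = 0 \<Longrightarrow> b \<le> a \<Longrightarrow> g b \<le> g a"
  unfolding g_def using gW_mono[of a b] sl_mono[of b a] sl_ge1[of b] gW_nonneg[of a]
  by (intro mult_mono) auto
lemma g_le_coeff_bound: assumes "a \<in> U \<or> a = 0" shows "g a \<le> coeff_bound"
proof -
  have "gW a \<le> 2304 * exp 27648"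
  proof (cases "a = 0")
    case False
    then have "gW a \<le> \<gamma> a" using assms gW_le_\<gamma> by auto
    also have "\<dots> \<le> 2304 * exp 27648" using q_power_le[of a] q_ge1
      unfolding \<gamma>_def by (intro mult_mono) auto
    finally show ?thesis .
  qed (simp add: gW_nonpos)
  then show ?thesis using g_le_gW[OF assms] exp_gt_zero[of "27648::real"] unfolding coeff_bound_def by linarith
qed
lemma coeff_bound_ge1: "1 \<le> coeff_bound" using one_le_exp_iff[of "27648::real"] unfolding coeff_bound_def by linarith

lemma \<gamma>_v_le:
  assumes "u \<in> U" "i < n" "v i < u"
  shows "gW (v i) \<le> \<gamma> u * (q ^ i / q ^ rk u)"
proof (cases "v i = 0")
  case True
  then show ?thesis using \<gamma>_pos[of u] q_ge1 by (simp add: gW_nonpos)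
next
  case False
  then have "gW (v i) \<le> \<gamma> (v i)" using v_cases[OF assms(2)] gW_le_\<gamma> by auto
  also have "\<dots> \<le> (if u > m then 2304 else 1) * q ^ i"
    using power_increasing[OF rk_v_le[OF assms(2)] q_ge1] assms(3) one_le_power[OF q_ge1, of i]
    by (auto simp: \<gamma>_def)
  also have "\<dots> = \<gamma> u * (q ^ i / q ^ rk u)" using q_ge1 by (simp add: \<gamma>_def)
  finally show ?thesis .
qed

lemma q_telescope:
  assumes "i \<le> k"
  shows "q ^ k - q ^ i = 27648 / real n * (\<Sum>j=i..<k. q ^ j)"
  using assms
proof (induction rule: dec_induct)
  case (step j)
  have "q ^ Suc j = q ^ j + 27648 / real n * q ^ j" by (simp add: q_def algebra_simps)
  moreover have "(\<Sum>l=i..<Suc j. q ^ l) = (\<Sum>l=i..<j. q ^ l) + q ^ j" using step by simp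
  ultimately show ?case using step.IH by (simp only: distrib_left)
qed simp

lemma sum_q_le: 
  assumes "D \<subseteq> {..<k}"
  shows "(\<Sum>i\<in>D. q ^ i / q ^ k) \<le> real n / 27648"
proof -
  have "27648 / real n * (\<Sum>i\<in>D. q ^ i) \<le> 27648 / real n * (\<Sum>i=0..<k. q ^ i)"
    using assms q_ge1 by (intro mult_left_mono sum_mono2) auto
  also have "\<dots> = q ^ k - 1" using q_telescope[of 0 k] by simp
  finally have "27648 / real n * (\<Sum>i\<in>D. q ^ i) \<le> q ^ k" by simp
  then show ?thesis using q_ge1 n_pos by (simp flip: sum_divide_distrib add: field_simps)
qed

lemma drop_gain:
  assumes "u \<in> U" "D \<subseteq> {..<rk u}" and \<sigma>: "\<sigma> = (\<Sum>i\<in>D. q ^ i / q ^ rk u)"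
  shows "\<gamma> u * (27648 / real n) * \<sigma>\<^sup>2 / 2 \<le> (\<Sum>i\<in>D. \<gamma> u - gW (v i))"
proof -
  let ?k = "rk u" and ?a = "\<lambda>i. q ^ i / q ^ rk u"
  have fin: "finite D" using assms(2) finite_subset by blast
  have "\<gamma> u * (27648 / real n) * \<sigma>\<^sup>2 / 2 \<le> \<gamma> u * (27648 / real n) * (\<Sum>i\<in>D. \<Sum>j\<in>{j\<in>D. i \<le> j}. ?a i * ?a j)"
    using sum_sq_half_le[OF fin, of ?a] q_ge1 \<gamma>_pos[of u] unfolding \<sigma>
    by (auto simp: field_simps intro!: divide_right_mono)
  also have "\<dots> = (\<Sum>i\<in>D. \<gamma> u * (27648 / real n) * (\<Sum>j\<in>{j\<in>D. i \<le> j}. ?a i * ?a j))"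
    by (simp add: sum_distrib_left)
  also have "\<dots> \<le> (\<Sum>i\<in>D. \<gamma> u - gW (v i))"
  proof (rule sum_mono)
    fix i assume i: "i \<in> D"
    then have ik: "i < ?k" using assms by auto
    have "?a i \<le> 1" using ik power_increasing[of i ?k q] q_ge1 by simp
    then have "(\<Sum>j\<in>{j\<in>D. i \<le> j}. ?a i * ?a j) \<le> (\<Sum>j\<in>{j\<in>D. i \<le> j}. 1 * ?a j)"
      using q_ge1 by (intro sum_mono mult_right_mono) auto
    also have "\<dots> \<le> (\<Sum>j=i..<?k. ?a j)"
      using q_ge1 assms(2) by simp (intro sum_mono2, auto)
    also have "\<dots> = (\<Sum>j=i..<?k. q ^ j) / q ^ ?k" by (simp add: sum_divide_distrib)
    finally have "(27648 / real n) * (\<Sum>j\<in>{j\<in>D. i \<le> j}. ?a i * ?a j) \<le> (27648 / real n) * ((\<Sum>j=i..<?k. q ^ j) / q ^ ?k)"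
      by (intro mult_left_mono) auto
    also have "\<dots> = (q ^ ?k - q ^ i) / q ^ ?k" using q_telescope[of i ?k] ik by simp
    also have "\<dots> = 1 - ?a i" using q_ge1 by (simp add: diff_divide_distrib)
    finally have "\<gamma> u * ((27648 / real n) * (\<Sum>j\<in>{j\<in>D. i \<le> j}. ?a i * ?a j)) \<le> \<gamma> u * (1 - ?a i)"
      using \<gamma>_pos[of u] by (intro mult_left_mono) auto
    also have "\<dots> \<le> \<gamma> u - gW (v i)"
      using \<gamma>_v_le[OF assms(1), of i] ik less_rk_iff[of i u] by (simp add: algebra_simps)
    finally show "\<gamma> u * (27648 / real n) * (\<Sum>j\<in>{j\<in>D. i \<le> j}. ?a i * ?a j) \<le> \<gamma> u - gW (v i)"
      by (simp add: mult.assoc)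
  qed
  finally show ?thesis .
qed

lemma rank_gain:
  assumes "D \<subseteq> {i. i < n \<and> v i < a}"
  shows "(real (card D))\<^sup>2 / 2 \<le> (\<Sum>i\<in>D. real (rk a) - real (rk (v i)))"
proof -
  have D: "D \<subseteq> {..<rk a}" using assms rk_segment by simp
  then have fin: "finite D" using finite_subset by blast
  have "(real (card D))\<^sup>2 / 2 \<le> (\<Sum>i\<in>D. \<Sum>j\<in>{j\<in>D. i \<le> j}. 1)"
    using sum_sq_half_le[OF fin, of "\<lambda>_. 1"] by simp
  also have "\<dots> \<le> (\<Sum>i\<in>D. real (rk a) - real (rk (v i)))"
  proof (rule sum_mono)
    fix i assume i: "i \<in> D"
    have "card {j\<in>D. i \<le> j} \<le> card {i..<rk a}" using D by (intro card_mono) auto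
    moreover have "rk (v i) \<le> i" "i < rk a" using i D assms rk_v_le by auto
    ultimately show "(\<Sum>j\<in>{j\<in>D. i \<le> j}. 1) \<le> real (rk a) - real (rk (v i))" by simp
  qed
  finally show ?thesis .
qed

end

section \<open>Change of the potential in an accepted step\<close>

context weights begin

abbreviation hg :: "nat \<Rightarrow> real" where "hg i \<equiv> g (v i)"
abbreviation \<beta> :: real where "\<beta> \<equiv> g m"

lemma hg_nonneg: "i < n \<Longrightarrow> 0 \<le> hg i" using g_nonneg v_cases by auto
lemma \<beta>_nonneg: "0 \<le> \<beta>" using g_nonneg m_U by auto

text \<open>\<open>O'\<close> and \<open>Z\<close> are the bits switched off and on, \<open>d\<close> and \<open>e\<close> the decrease and the
  increase of the number of one-bits. Monotonicity of \<open>gW a / a\<close> turns the acceptance inequality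
  into one for the potential; only items below \<open>Lv a\<close> escape it.\<close>

lemma ratio_bound:
  assumes "finite O'" "finite Z" "O' \<subseteq> {..<n}" "Z \<subseteq> {..<n}" "0 \<le> d" "0 \<le> e" "a \<in> U"
    and le: "(\<Sum>i\<in>Z. v i) + m * e \<le> (\<Sum>i\<in>O'. v i) + m * d"
    and O': "\<And>i. i \<in> O' \<Longrightarrow> v i \<le> a" and d: "0 < d \<Longrightarrow> m \<le> a"
    and c: "0 \<le> c" "\<And>i. i \<in> Z \<Longrightarrow> sl (v i) \<le> c" "0 < e \<Longrightarrow> sl m \<le> c"
  shows "(\<Sum>i\<in>Z. hg i) + \<beta> * e \<le> (\<Sum>i\<in>{i\<in>Z. v i < Lv a}. hg i) + (if m < Lv a then \<beta> else 0) * e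
           + c * ((\<Sum>i\<in>O'. gW (v i)) + gW m * d)"
proof -
  let ?u = "Lv a" and ?\<rho> = "\<gamma> (Lv a) / Lv a"
  have \<rho>: "0 \<le> ?\<rho>" using \<gamma>_pos[of ?u] U_pos[OF Lv(1)[OF assms(7)]] by simp
  let ?Z = "{i\<in>Z. \<not> v i < ?u}" and ?e = "if m < ?u then 0 else e"
  have e: "0 \<le> ?e" "?e \<le> e" using assms by auto
  have Zle: "(\<Sum>i\<in>?Z. v i) \<le> (\<Sum>i\<in>Z. v i)"
    using assms v_nonneg by (intro sum_mono2) auto
  have "(\<Sum>i\<in>?Z. hg i) + \<beta> * ?e \<le> (\<Sum>i\<in>?Z. c * (?\<rho> * v i)) + c * (?\<rho> * m) * ?e"
  proof (intro add_mono sum_mono)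
    fix i assume i: "i \<in> ?Z"
    then have "gW (v i) \<le> ?\<rho> * v i" using gW_le_ratio[OF assms(7)] by auto
    then show "hg i \<le> c * (?\<rho> * v i)"
      unfolding g_def using c i gW_nonneg[OF v_cases, of i] assms(4) sl_ge1[of "v i"]
      by (subst mult.commute, intro mult_mono) auto
  next
    show "\<beta> * ?e \<le> c * (?\<rho> * m) * ?e"
    proof (cases "m < ?u \<or> e = 0")
      case True then show ?thesis by auto
    next
      case False
      then have "gW m \<le> ?\<rho> * m" using gW_le_ratio[OF assms(7)] by auto
      moreover have "sl m \<le> c" using False assms(6) c by auto
      ultimately have "\<beta> \<le> c * (?\<rho> * m)"
        unfolding g_def using c gW_nonneg m_U sl_ge1[of m]
        by (subst mult.commute, intro mult_mono) auto
      then show ?thesis using e by (intro mult_right_mono) auto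
    qed
  qed
  also have "\<dots> = c * ?\<rho> * ((\<Sum>i\<in>?Z. v i) + m * ?e)"
    unfolding distrib_left sum_distrib_left by (simp only: mult.assoc)
  also have "\<dots> \<le> c * ?\<rho> * ((\<Sum>i\<in>O'. v i) + m * d)"
  proof (rule mult_left_mono)
    have "m * ?e \<le> m * e" using e m_pos by (intro mult_left_mono) auto
    then show "(\<Sum>i\<in>?Z. v i) + m * ?e \<le> (\<Sum>i\<in>O'. v i) + m * d" using le Zle by linarith
  qed (rule mult_nonneg_nonneg[OF c(1) \<rho>])
  also have "\<dots> = c * ((\<Sum>i\<in>O'. ?\<rho> * v i) + ?\<rho> * m * d)"
    unfolding distrib_left sum_distrib_left by (simp only: mult.assoc)
  also have "\<dots> \<le> c * ((\<Sum>i\<in>O'. gW (v i)) + gW m * d)"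
  proof (intro mult_left_mono add_mono sum_mono c)
    fix i assume "i \<in> O'"
    then show "?\<rho> * v i \<le> gW (v i)" using gW_ge_ratio[OF assms(7) v_cases O'] assms(3) by auto
  next
    show "?\<rho> * m * d \<le> gW m * d"
    proof (cases "d = 0")
      case False
      then have "m \<le> a" using d assms(5) by auto
      then have "?\<rho> * m \<le> gW m" using gW_ge_ratio[OF assms(7)] m_U by auto
      then show ?thesis using assms(5) by (intro mult_right_mono) auto
    qed simp
  qed
  finally have *: "(\<Sum>i\<in>?Z. hg i) + \<beta> * ?e \<le> c * ((\<Sum>i\<in>O'. gW (v i)) + gW m * d)" .
  have "(\<Sum>i\<in>Z. hg i) = (\<Sum>i\<in>{i\<in>Z. v i < ?u} \<union> ?Z. hg i)" by (rule sum.cong) auto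
  also have "\<dots> = (\<Sum>i\<in>{i\<in>Z. v i < ?u}. hg i) + (\<Sum>i\<in>?Z. hg i)"
    by (rule sum.union_disjoint) (use \<open>finite Z\<close> in auto)
  finally show ?thesis using * by (cases "m < ?u") simp_all
qed

definition potential :: "nat set \<Rightarrow> real" where
  "potential X = (\<Sum>i\<in>X. hg i) + \<beta> * (real (card X) - real B)"
definition excess :: "nat set \<Rightarrow> real" where
  "excess X = (\<Sum>i\<in>X. v i) + m * (real (card X) - real B)"
definition flipset :: "nat set \<Rightarrow> nat set \<Rightarrow> nat set" where
  "flipset X S = (X - S) \<union> (S - X)"
definition accept :: "nat set \<Rightarrow> nat set \<Rightarrow> bool" where
  "accept X S \<longleftrightarrow> B \<le> card (flipset X S) \<and> excess (flipset X S) \<le> excess X"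

lemma flipset_sum:
  fixes f :: "nat \<Rightarrow> real"
  assumes "finite X" "finite S"
  shows "(\<Sum>i\<in>flipset X S. f i) = (\<Sum>i\<in>X. f i) + (\<Sum>i\<in>S - X. f i) - (\<Sum>i\<in>X \<inter> S. f i)"
proof -
  have "(\<Sum>i\<in>flipset X S. f i) = (\<Sum>i\<in>X - S. f i) + (\<Sum>i\<in>S - X. f i)"
    unfolding flipset_def by (rule sum.union_disjoint) (use assms in auto)
  moreover have "(\<Sum>i\<in>X. f i) = (\<Sum>i\<in>X \<inter> S. f i) + (\<Sum>i\<in>X - S. f i)"
    using sum.Int_Diff[OF assms(1), of f S] .
  ultimately show ?thesis by linarith
qed

lemma flipset_card:
  assumes "finite X" "finite S"
  shows "real (card (flipset X S)) = real (card X) + real (card (S - X)) - real (card (X \<inter> S))"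
  using flipset_sum[OF assms, of "\<lambda>_. 1"] by simp

lemma potential_flipset:
  assumes "finite X" "finite S"
  shows "potential (flipset X S) - potential X = (\<Sum>i\<in>S - X. hg i) - (\<Sum>i\<in>X \<inter> S. hg i)
     + \<beta> * (real (card (S - X)) - real (card (X \<inter> S)))"
  unfolding potential_def flipset_sum[OF assms] flipset_card[OF assms] by (simp add: algebra_simps)

lemma excess_flipset:
  assumes "finite X" "finite S"
  shows "excess (flipset X S) - excess X = (\<Sum>i\<in>S - X. v i) - (\<Sum>i\<in>X \<inter> S. v i)
     + m * (real (card (S - X)) - real (card (X \<inter> S)))"
  unfolding excess_def flipset_sum[OF assms] flipset_card[OF assms] by (simp add: algebra_simps)

lemma unchanged_of_no_decrease:
  assumes "X \<subseteq> {..<n}" "S \<subseteq> {..<n}" "excess (flipset X S) \<le> excess X"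
    and "\<And>i. i \<in> X \<inter> S \<Longrightarrow> v i = 0" "card (X \<inter> S) \<le> card (S - X)"
  shows "potential (flipset X S) = potential X"
proof -
  have fin: "finite X" "finite S" using assms finite_subset[of _ "{..<n}"] by auto
  have "(\<Sum>i\<in>S - X. v i) + m * (real (card (S - X)) - real (card (X \<inter> S))) \<le> 0"
    using excess_flipset[OF fin] assms(3,4) by simp
  moreover have "0 \<le> (\<Sum>i\<in>S - X. v i)" using assms v_nonneg by (intro sum_nonneg) auto
  moreover have "0 \<le> m * (real (card (S - X)) - real (card (X \<inter> S)))" using assms m_pos by simp
  ultimately have *: "(\<Sum>i\<in>S - X. v i) = 0" "m * (real (card (S - X)) - real (card (X \<inter> S))) = 0"
    by linarith+
  have nn: "\<And>i. i \<in> S - X \<Longrightarrow> 0 \<le> v i" using assms(2) v_nonneg by auto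
  have "\<forall>i\<in>S - X. v i = 0"
    by (rule iffD1[OF sum_nonneg_eq_0_iff[OF finite_Diff[OF fin(2)] nn] *(1)])
  moreover have "real (card (S - X)) - real (card (X \<inter> S)) = 0" using *(2) m_pos by simp
  ultimately show ?thesis using potential_flipset[OF fin] assms(4) by (simp add: g_zero)
qed

abbreviation (input) I :: "nat \<Rightarrow> nat set \<Rightarrow> real" where "I i S \<equiv> of_bool (i \<in> S)"

abbreviation Lo :: "nat set \<Rightarrow> real \<Rightarrow> nat set" where "Lo X a \<equiv> {j. j < n \<and> j \<notin> X \<and> v j < Lv a}"
abbreviation \<beta>L :: "real \<Rightarrow> real" where "\<beta>L a \<equiv> (if m < Lv a then \<beta> else 0)"

lemma sum_indicator:
  fixes f :: "nat \<Rightarrow> real"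
  assumes "finite D" shows "(\<Sum>i\<in>D. f i * I i S) = (\<Sum>i\<in>D \<inter> S. f i)"
proof -
  have "(\<Sum>i\<in>D. f i * I i S) = (\<Sum>i\<in>D. if i \<in> S then f i else 0)" by (rule sum.cong) auto
  then show ?thesis using assms by (simp add: sum.inter_restrict)
qed

lemma Lo_sum:
  assumes "S \<subseteq> {..<n}"
  shows "(\<Sum>j\<in>Lo X a. hg j * I j S) = (\<Sum>j\<in>{j\<in>S - X. v j < Lv a}. hg j)"
  unfolding sum_indicator[OF finite_Collect_conjI[OF disjI1[OF finite_Collect_less_nat]]]
  by (rule sum.cong) (use assms in auto)

lemma card_sum:
  assumes "S \<subseteq> {..<n}"
  shows "(\<Sum>j\<in>{..<n} - X. I j S) = real (card (S - X))"
proof -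
  have "({..<n} - X) \<inter> S = S - X" using assms by auto
  then show ?thesis using sum_indicator[of "{..<n} - X" "\<lambda>_. 1" S] by simp
qed

text \<open>Majorants of the potential gained by an accepted step, as polynomials in the flip indicators:
  \<open>bad_loose\<close> for more than \<open>B\<close> one-bits; for exactly \<open>B\<close> one-bits, \<open>bad_two\<close> covers
  steps that switch off two heavy bits and \<open>bad_one\<close> those that switch off only the heavy bit \<open>t\<close>.\<close>

definition bad_loose :: "nat set \<Rightarrow> nat \<Rightarrow> nat set \<Rightarrow> real" where
  "bad_loose X i S = 1/24 * (hg i + \<beta>)
     + (if 0 < v i then (\<Sum>j\<in>Lo X (v i). hg j * I j S) + \<beta>L (v i) * (\<Sum>j\<in>{..<n} - X. I j S) else 0)
     + (\<Sum>j\<in>Lo X m. hg j * I j S)"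

lemma bad_loose_nonneg: "i < n \<Longrightarrow> 0 \<le> bad_loose X i S"
  unfolding bad_loose_def using hg_nonneg \<beta>_nonneg
  by (auto intro!: add_nonneg_nonneg sum_nonneg mult_nonneg_nonneg)

lemma loose_pointwise:
  assumes X: "X \<subseteq> {..<n}" and S: "S \<subseteq> {..<n}"
    and acc: "excess (flipset X S) \<le> excess X"
  shows "potential (flipset X S) - potential X \<le> (\<Sum>i\<in>X. bad_loose X i S * I i S) - (\<Sum>i\<in>X. (hg i + \<beta>) * of_bool (S = {i}))"
proof -
  have fin: "finite X" "finite S" using assms finite_subset[of _ "{..<n}"] by auto
  let ?O = "X \<inter> S" and ?Z = "S - X"
  have bn: "0 \<le> (\<Sum>i\<in>X. bad_loose X i S * I i S)"
    using bad_loose_nonneg X by (intro sum_nonneg) auto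
  show ?thesis
  proof (cases "\<exists>i\<in>X. S = {i}")
    case True
    then obtain i where i: "i \<in> X" "S = {i}" by auto
    have "(\<Sum>j\<in>X. (hg j + \<beta>) * of_bool (S = {j})) = (\<Sum>j\<in>X. if j = i then hg j + \<beta> else 0)"
      using i by (intro sum.cong) auto
    also have "\<dots> = hg i + \<beta>" using i fin by simp
    finally show ?thesis using bn potential_flipset[OF fin] i by simp
  next
    case False
    then have z: "(\<Sum>i\<in>X. (hg i + \<beta>) * of_bool (S = {i})) = 0" by (intro sum.neutral) auto
    define d where "d = max 0 (real (card ?O) - real (card ?Z))"
    define e where "e = max 0 (real (card ?Z) - real (card ?O))"
    have de: "0 \<le> d" "0 \<le> e" "real (card ?Z) - real (card ?O) = e - d" "d \<le> card ?O" "e \<le> card ?Z"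
      by (auto simp: d_def e_def)
    have le: "(\<Sum>i\<in>?Z. v i) + m * e \<le> (\<Sum>i\<in>?O. v i) + m * d"
      using acc excess_flipset[OF fin] de(3) by (simp add: algebra_simps)
    have arith: "z - h - k \<le> r + 1/24 * h'"
      if "z \<le> r + 25/24 * (x + y)" "x \<le> h" "y \<le> k" "k \<le> k'" "h' = h + k'"
      for z h k r h' x y k' :: real using that by argo
    have main: "potential (flipset X S) - potential X \<le> ((\<Sum>i\<in>{i\<in>?Z. v i < Lv a}. hg i) + \<beta>L a * e)
         + 1/24 * (\<Sum>i\<in>?O. hg i + \<beta>)"
      if a: "a \<in> U" "\<And>i. i \<in> ?O \<Longrightarrow> v i \<le> a" "0 < d \<Longrightarrow> m \<le> a" for a
    proof -
      have "(\<Sum>i\<in>?Z. hg i) + \<beta> * e \<le> (\<Sum>i\<in>{i\<in>?Z. v i < Lv a}. hg i) + \<beta>L a * e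
           + 25/24 * ((\<Sum>i\<in>?O. gW (v i)) + gW m * d)"
        by (rule ratio_bound) (use a de le fin assms sl_le in auto)
      then have "(\<Sum>i\<in>?Z. hg i) + \<beta> * e - (\<Sum>i\<in>?O. hg i) - \<beta> * d
          \<le> ((\<Sum>i\<in>{i\<in>?Z. v i < Lv a}. hg i) + \<beta>L a * e) + 1/24 * (\<Sum>i\<in>?O. hg i + \<beta>)"
      proof (rule arith)
        show "(\<Sum>i\<in>?O. gW (v i)) \<le> (\<Sum>i\<in>?O. hg i)"
          using X gW_le_g[OF v_cases] by (intro sum_mono) auto
        show "gW m * d \<le> \<beta> * d" using gW_le_g m_U de by (intro mult_right_mono) auto
        show "\<beta> * d \<le> \<beta> * card ?O" using \<beta>_nonneg de by (intro mult_left_mono) auto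
        show "(\<Sum>i\<in>?O. hg i + \<beta>) = (\<Sum>i\<in>?O. hg i) + \<beta> * card ?O" by (simp add: sum.distrib)
      qed
      moreover have "potential (flipset X S) - potential X = (\<Sum>i\<in>?Z. hg i) + \<beta> * e - (\<Sum>i\<in>?O. hg i) - \<beta> * d"
        using potential_flipset[OF fin] de(3) by (simp add: algebra_simps)
      ultimately show ?thesis by simp
    qed
    have bs: "(\<Sum>i\<in>X. bad_loose X i S * I i S) = (\<Sum>i\<in>?O. bad_loose X i S)"
      using sum_indicator[OF fin(1)] .
    let ?r = "\<lambda>i. bad_loose X i S - 1/24 * (hg i + \<beta>)"
    have rn: "0 \<le> ?r i" if "i \<in> ?O" for i
      unfolding bad_loose_def using hg_nonneg \<beta>_nonneg that X
      by (auto intro!: add_nonneg_nonneg sum_nonneg mult_nonneg_nonneg)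
    have bs': "(\<Sum>i\<in>X. bad_loose X i S * I i S) \<ge> 1/24 * (\<Sum>i\<in>?O. hg i + \<beta>) + ?r t" if t: "t \<in> ?O" for t
    proof -
      have "?r t \<le> (\<Sum>i\<in>?O. ?r i)" using t fin rn by (intro member_le_sum) auto
      also have "\<dots> = (\<Sum>i\<in>?O. bad_loose X i S) - 1/24 * (\<Sum>i\<in>?O. hg i + \<beta>)"
        by (simp add: sum_subtractf sum_distrib_left)
      finally show ?thesis using bs by linarith
    qed
    have Lm: "0 \<le> (\<Sum>j\<in>Lo X m. hg j * I j S)" using hg_nonneg by (intro sum_nonneg) auto
    show ?thesis
    proof (cases "0 < d \<and> (\<forall>i\<in>?O. v i \<le> m)")
      case True
      then have "card ?O \<noteq> 0" by (auto simp: d_def)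
      then obtain t where t: "t \<in> ?O" by (metis card.empty ex_in_conv)
      have "e = 0" using True by (auto simp: d_def e_def)
      then have "potential (flipset X S) - potential X \<le> (\<Sum>j\<in>Lo X m. hg j * I j S) + 1/24 * (\<Sum>i\<in>?O. hg i + \<beta>)"
        using main[of m] True m_U Lo_sum[OF S] by auto
      moreover have "(\<Sum>j\<in>Lo X m. hg j * I j S) \<le> ?r t"
        unfolding bad_loose_def using hg_nonneg \<beta>_nonneg t X
        by (auto intro!: add_nonneg_nonneg sum_nonneg mult_nonneg_nonneg)
      ultimately show ?thesis using bs'[OF t] z by linarith
    next
      case nd: False
      show ?thesis
      proof (cases "\<exists>i\<in>?O. 0 < v i")
        case True
        then have ne: "?O \<noteq> {}" by auto
        define a where "a = Max (v ` ?O)"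
        have "a \<in> v ` ?O" unfolding a_def using fin ne by (intro Max_in) auto
        then obtain t where t: "t \<in> ?O" "v t = a" by auto
        have mx: "v i \<le> a" if "i \<in> ?O" for i using that fin by (auto simp: a_def)
        have apos: "0 < a" using True mx by force
        have aU: "a \<in> U" using t apos v_U[of t] X by auto
        have "m \<le> a" if "0 < d" using nd that mx by force
        then have "potential (flipset X S) - potential X \<le> (\<Sum>j\<in>Lo X a. hg j * I j S) + \<beta>L a * e + 1/24 * (\<Sum>i\<in>?O. hg i + \<beta>)"
          using main[OF aU mx] Lo_sum[OF S] by auto
        moreover have "\<beta>L a * e \<le> \<beta>L a * (\<Sum>j\<in>{..<n} - X. I j S)"
          unfolding card_sum[OF S] using de \<beta>_nonneg by (intro mult_left_mono) auto
        moreover have "(\<Sum>j\<in>Lo X a. hg j * I j S) + \<beta>L a * (\<Sum>j\<in>{..<n} - X. I j S) \<le> ?r t"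
          unfolding bad_loose_def using Lm t apos by auto
        ultimately show ?thesis using bs'[OF t(1)] z by linarith
      next
        case no: False
        then have v0: "\<And>i. i \<in> ?O \<Longrightarrow> v i = 0" using X v_nonneg by force
        then have "\<not> 0 < d" using nd m_pos by fastforce
        then have "card ?O \<le> card ?Z" by (auto simp: d_def)
        then have "potential (flipset X S) = potential X" using unchanged_of_no_decrease[OF X S acc v0] by auto
        then show ?thesis using bn z by simp
      qed
    qed
  qed
qed

definition Dn :: "nat set \<Rightarrow> nat \<Rightarrow> nat set" where "Dn X t = {j. j < n \<and> j \<notin> X \<and> v j < v t}"

definition bad_two :: "nat set \<Rightarrow> nat \<Rightarrow> nat set \<Rightarrow> real" where
  "bad_two X t S = 1/24 * hg t + (\<Sum>j\<in>Lo X (v t). hg j * I j S) + \<beta>L (v t) * (\<Sum>j\<in>{..<n} - X. I j S)"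

definition bad_one :: "nat set \<Rightarrow> nat \<Rightarrow> nat set \<Rightarrow> real" where
  "bad_one X t S = (\<Sum>j\<in>Lo X (v t). hg j * (\<Sum>k\<in>Dn X t - {j}. I j S * I k S))
      + \<beta>L (v t) * (\<Sum>j\<in>Dn X t. \<Sum>k\<in>Dn X t - {j}. I j S * I k S)"

lemma bad_two_nonneg: "t < n \<Longrightarrow> 0 \<le> bad_two X t S"
  unfolding bad_two_def using hg_nonneg \<beta>_nonneg
  by (auto intro!: add_nonneg_nonneg sum_nonneg mult_nonneg_nonneg)

lemma bad_one_nonneg: "t < n \<Longrightarrow> 0 \<le> bad_one X t S"
  unfolding bad_one_def using hg_nonneg \<beta>_nonneg
  by (auto intro!: add_nonneg_nonneg sum_nonneg mult_nonneg_nonneg)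

lemma indicator_pair_sum:
  assumes "finite D" "Z = D \<inter> S"
  shows "(\<Sum>k\<in>D - {j}. I j S * I k S) = I j S * real (card (Z - {j}))"
proof -
  have "(D - {j}) \<inter> S = Z - {j}" using assms by auto
  then show ?thesis using sum_indicator[of "D - {j}" "\<lambda>_. I j S" S] assms by simp
qed

lemma tight_pointwise:
  assumes X: "X \<subseteq> {..<n}" and B: "card X = B" and S: "S \<subseteq> {..<n}"
    and acc: "accept X S" and Xh: "Xh = {t\<in>X. 0 < v t}"
  shows "potential (flipset X S) - potential X \<le> (\<Sum>t\<in>Xh. \<Sum>t'\<in>Xh - {t}. bad_two X t S * (I t S * I t' S))
      + (\<Sum>t\<in>Xh. bad_one X t S * I t S)
      - (\<Sum>t\<in>Xh. \<Sum>j\<in>Dn X t. (hg t - hg j) * of_bool (S = {t, j}))"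
    (is "_ \<le> ?two + ?one - ?good")
proof -
  have fin: "finite X" "finite S" using assms finite_subset[of _ "{..<n}"] by auto
  have finh: "finite Xh" using fin Xh by auto
  have XhX: "Xh \<subseteq> X" "Xh \<subseteq> {..<n}" using Xh X by auto
  have finD: "finite (Dn X t)" for t by (simp add: Dn_def)
  let ?O = "X \<inter> S" and ?Z = "S - X"
  have two_nn: "0 \<le> ?two" using XhX by (intro sum_nonneg mult_nonneg_nonneg bad_two_nonneg) auto
  have one_nn: "0 \<le> ?one" using XhX by (intro sum_nonneg mult_nonneg_nonneg bad_one_nonneg) auto
  have Ev: "excess (flipset X S) \<le> excess X" using acc by (simp add: accept_def)
  have card: "card ?O \<le> card ?Z"
    using acc flipset_card[OF fin] B by (simp add: accept_def)
  define e where "e = real (card ?Z) - real (card ?O)"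
  have e: "0 \<le> e" using card by (simp add: e_def)
  have le: "(\<Sum>i\<in>?Z. v i) + m * e \<le> (\<Sum>i\<in>?O. v i)"
    using Ev excess_flipset[OF fin] by (simp add: e_def)
  have dG: "potential (flipset X S) - potential X = (\<Sum>i\<in>?Z. hg i) + \<beta> * e - (\<Sum>i\<in>?O. hg i)"
    using potential_flipset[OF fin] by (simp add: e_def)
  let ?Oh = "Xh \<inter> S"
  have v0: "v i = 0" if "i \<in> ?O - ?Oh" for i
    using that Xh X v_nonneg[of i] by auto
  have Osum: "(\<Sum>i\<in>?O. f (v i)) = (\<Sum>i\<in>?Oh. f (v i))" if "f 0 = 0" for f :: "real \<Rightarrow> real"
  proof (rule sum.mono_neutral_right)
    show "\<forall>i\<in>?O - ?Oh. f (v i) = 0" using v0 that by metis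
  qed (use fin XhX in auto)
  show ?thesis
  proof (cases "\<exists>t\<in>Xh. \<exists>j\<in>Dn X t. S = {t, j}")
    case True
    then obtain t j where tj: "t \<in> Xh" "j \<in> Dn X t" "S = {t, j}" by auto
    then have tj': "t \<in> X" "j \<notin> X" "t \<noteq> j" using XhX by (auto simp: Dn_def)
    have eq: "S = {s, k} \<longleftrightarrow> s = t \<and> k = j" if "s \<in> Xh" "k \<in> Dn X s" for s k
      using that tj tj' XhX by (auto simp: Dn_def doubleton_eq_iff)
    have "?good = (\<Sum>s\<in>Xh. \<Sum>k\<in>Dn X s. if k = j then (if s = t then hg s - hg k else 0) else 0)"
      by (intro sum.cong refl) (use eq in auto)
    also have "\<dots> = (\<Sum>s\<in>Xh. if s = t then hg s - hg j else 0)"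
      by (intro sum.cong refl) (use finD tj in \<open>auto simp: sum.delta\<close>)
    also have "\<dots> = hg t - hg j" using finh tj by (simp add: sum.delta)
    finally have good: "?good = hg t - hg j" .
    have OZ: "?O = {t}" "?Z = {j}" using tj tj' by auto
    then have "potential (flipset X S) - potential X = hg j - hg t" using dG by (simp add: e_def)
    then show ?thesis using good two_nn one_nn by linarith
  next
    case ng: False
    have good: "?good = 0" by (intro sum.neutral ballI) (use ng in auto)
    consider "?Oh = {}" | t where "?Oh = {t}" | "2 \<le> card ?Oh"
    proof (cases "card ?Oh = 0 \<or> card ?Oh = 1")
      case True then show ?thesis using finh that(1,2) by (auto simp: card_1_singleton_iff)
    next
      case False then show ?thesis using that(3) by linarith
    qed
    then show ?thesis
    proof cases
      case 1
      then have "\<And>i. i \<in> ?O \<Longrightarrow> v i = 0" using v0 by auto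
      then have "potential (flipset X S) = potential X" by (rule unchanged_of_no_decrease[OF X S Ev _ card])
      then show ?thesis using good two_nn one_nn by linarith
    next
      case 3
      then have ne: "?Oh \<noteq> {}" by auto
      define a where "a = Max (v ` ?Oh)"
      have "a \<in> v ` ?Oh" unfolding a_def using finh ne by (intro Max_in) auto
      then obtain t where t: "t \<in> ?Oh" "v t = a" by auto
      have apos: "0 < a" using t Xh by auto
      have aU: "a \<in> U" using t v_U[of t] XhX apos by auto
      have mx: "v i \<le> a" if "i \<in> ?O" for i
      proof (cases "i \<in> ?Oh")
        case True then show ?thesis using finh by (auto simp: a_def)
      next
        case False then show ?thesis using v0[of i] that apos by auto
      qed
      have "(\<Sum>i\<in>?Z. hg i) + \<beta> * e \<le> (\<Sum>i\<in>{i\<in>?Z. v i < Lv a}. hg i) + \<beta>L a * e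
           + 25/24 * ((\<Sum>i\<in>?O. gW (v i)) + gW m * 0)"
        by (rule ratio_bound) (use aU mx e le fin X S sl_le in auto)
      moreover have "(\<Sum>i\<in>?O. gW (v i)) \<le> (\<Sum>i\<in>?O. hg i)"
        using X gW_le_g[OF v_cases] by (intro sum_mono) auto
      moreover have "\<beta>L a * e \<le> \<beta>L a * real (card ?Z)"
        using \<beta>_nonneg by (intro mult_left_mono) (auto simp: e_def)
      ultimately have "potential (flipset X S) - potential X \<le> ((\<Sum>i\<in>{i\<in>?Z. v i < Lv a}. hg i) + \<beta>L a * real (card ?Z))
           + 1/24 * (\<Sum>i\<in>?O. hg i)"
        unfolding dG by simp
      also have "\<dots> = (bad_two X t S - 1/24 * hg t) + 1/24 * (\<Sum>i\<in>?Oh. hg i)"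
        using Osum[of g] Lo_sum[OF S, of X a] card_sum[OF S, of X] t by (simp add: bad_two_def g_zero)
      also have "\<dots> \<le> (\<Sum>i\<in>?Oh. bad_two X i S - 1/24 * hg i) + 1/24 * (\<Sum>i\<in>?Oh. hg i)"
      proof -
        have "0 \<le> bad_two X i S - 1/24 * hg i" if "i \<in> ?Oh" for i
          unfolding bad_two_def using hg_nonneg \<beta>_nonneg
          by (auto intro!: add_nonneg_nonneg sum_nonneg mult_nonneg_nonneg)
        then show ?thesis
          using member_le_sum[OF t(1), of "\<lambda>i. bad_two X i S - 1/24 * hg i"] finh by simp
      qed
      also have "\<dots> = (\<Sum>i\<in>?Oh. bad_two X i S)" by (simp add: sum_subtractf sum_distrib_left)
      also have "\<dots> = (\<Sum>i\<in>Xh. bad_two X i S * I i S)" using sum_indicator[OF finh] by simp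
      also have "\<dots> \<le> ?two"
      proof (rule sum_mono)
        fix i assume i: "i \<in> Xh"
        have eq: "(\<Sum>t'\<in>Xh - {i}. bad_two X i S * (I i S * I t' S)) = bad_two X i S * (I i S * real (card (?Oh - {i})))"
          using indicator_pair_sum[OF finh refl, of i S] by (simp add: sum_distrib_left[symmetric])
        have "I i S * 1 \<le> I i S * real (card (?Oh - {i}))"
          using 3 finh i by (cases "i \<in> S") (auto simp: card_Diff_singleton)
        from mult_left_mono[OF this bad_two_nonneg, of i X S]
        show "bad_two X i S * I i S \<le> (\<Sum>t'\<in>Xh - {i}. bad_two X i S * (I i S * I t' S))"
          unfolding eq mult_1_right using i XhX by blast
      qed
      finally show ?thesis using good one_nn by linarith
    next
      case (2 t)
      have t: "t \<in> X" "t \<in> S" "0 < v t" "t < n" using 2 Xh X by auto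
      have tU: "v t \<in> U" using v_U t by auto
      have Ov: "(\<Sum>i\<in>?O. v i) = v t" using Osum[of "\<lambda>x. x"] 2 by simp
      have Og: "(\<Sum>i\<in>?O. hg i) = hg t" using Osum[of g] 2 by (simp add: g_zero)
      have OW: "(\<Sum>i\<in>?O. gW (v i)) = gW (v t)" using Osum[of gW] 2 by (simp add: gW_nonpos)
      have nnZ: "\<And>i. i \<in> ?Z \<Longrightarrow> 0 \<le> v i" using S v_nonneg by auto
      show ?thesis
      proof (cases "\<exists>j\<in>?Z. v t \<le> v j")
        case True
        then obtain j where j: "j \<in> ?Z" "v t \<le> v j" by auto
        have "(\<Sum>i\<in>?Z. v i) = v j + (\<Sum>i\<in>?Z - {j}. v i)" using fin j by (simp add: sum.remove)
        moreover have nn: "\<And>i. i \<in> ?Z - {j} \<Longrightarrow> 0 \<le> v i" using nnZ by auto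
        then have "0 \<le> (\<Sum>i\<in>?Z - {j}. v i)" by (rule sum_nonneg)
        moreover have "0 \<le> m * e" using e m_pos by simp
        ultimately have *: "(\<Sum>i\<in>?Z - {j}. v i) = 0" "m * e = 0" "v j = v t"
          using le Ov j(2) by linarith+
        have "\<forall>i\<in>?Z - {j}. v i = 0"
          by (rule iffD1[OF sum_nonneg_eq_0_iff[OF _ nn] *(1)]) (use fin in auto)
        then have "(\<Sum>i\<in>?Z - {j}. hg i) = 0" by (intro sum.neutral) (auto simp: g_zero)
        then have "(\<Sum>i\<in>?Z. hg i) = hg j" using fin j by (simp add: sum.remove)
        moreover have "e = 0" using *(2) m_pos by simp
        ultimately have "potential (flipset X S) - potential X = 0" using dG Og *(3) by simp
        then show ?thesis using good two_nn one_nn by linarith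
      next
        case False
        then have ZD: "?Z = Dn X t \<inter> S" using S by (auto simp: Dn_def not_le)
        have tO: "t \<in> ?O" using t by auto
        have O1: "1 \<le> card ?O" using tO fin by (metis One_nat_def Suc_leI card_gt_0_iff empty_iff finite_Int)
        have Z2: "2 \<le> card ?Z"
        proof (rule ccontr)
          assume "\<not> 2 \<le> card ?Z"
          then have 1: "card ?Z = 1" "card ?O = 1" using card O1 by linarith+
          then obtain j where "?Z = {j}" by (meson card_1_singletonE)
          moreover have "?O = {t}" using 1(2) tO by (metis card_1_singletonE singletonD)
          ultimately have "S = {t, j}" "j \<in> Dn X t" using ZD by auto
          then show False using ng 2 by auto
        qed
        have me: "m \<le> v t" if "0 < e"
        proof -
          have "1 \<le> e" using that by (simp add: e_def)
          then have "m * 1 \<le> m * e" using m_pos by (intro mult_left_mono) auto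
          moreover have "0 \<le> (\<Sum>i\<in>?Z. v i)" using nnZ by (rule sum_nonneg)
          ultimately show ?thesis using le Ov by linarith
        qed
        have "(\<Sum>i\<in>?Z. hg i) + \<beta> * e \<le> (\<Sum>i\<in>{i\<in>?Z. v i < Lv (v t)}. hg i) + \<beta>L (v t) * e
             + sl (v t) * ((\<Sum>i\<in>?O. gW (v i)) + gW m * 0)"
        proof (rule ratio_bound)
          show "v i \<le> v t" if "i \<in> ?O" for i
            using that v0[of i] 2 t by (cases "i = t") auto
          show "0 \<le> sl (v t)" using sl_ge1[of "v t"] by simp
          show "sl (v i) \<le> sl (v t)" if "i \<in> ?Z" for i
            using that False by (intro sl_mono less_imp_le) (auto simp: not_le)
          show "sl m \<le> sl (v t)" if "0 < e" using me[OF that] by (rule sl_mono)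
        qed (use fin X S e le tU in auto)
        then have "potential (flipset X S) - potential X \<le> (\<Sum>i\<in>{i\<in>?Z. v i < Lv (v t)}. hg i) + \<beta>L (v t) * e"
          unfolding dG Og OW by (simp add: g_def mult.commute)
        also have "\<dots> \<le> bad_one X t S"
          unfolding bad_one_def indicator_pair_sum[OF finD ZD]
        proof (intro add_mono mult_left_mono)
          show "(\<Sum>i\<in>{i\<in>?Z. v i < Lv (v t)}. hg i) \<le> (\<Sum>j\<in>Lo X (v t). hg j * (I j S * real (card (?Z - {j}))))"
            unfolding Lo_sum[OF S, symmetric]
          proof (rule sum_mono)
            fix j assume j: "j \<in> Lo X (v t)"
            have "I j S * 1 \<le> I j S * real (card (?Z - {j}))"
              using Z2 fin j by (cases "j \<in> S") (auto simp: card_Diff_singleton)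
            then show "hg j * I j S \<le> hg j * (I j S * real (card (?Z - {j})))"
              using hg_nonneg[of j] j by (intro mult_left_mono) auto
          qed
          have "e \<le> real (card ?Z)" by (simp add: e_def)
          also have "\<dots> = (\<Sum>j\<in>Dn X t. 1 * I j S)" unfolding sum_indicator[OF finD] ZD by simp
          also have "\<dots> \<le> (\<Sum>j\<in>Dn X t. I j S * real (card (?Z - {j})))"
          proof (rule sum_mono)
            fix j assume "j \<in> Dn X t"
            then show "1 * I j S \<le> I j S * real (card (?Z - {j}))"
              using Z2 fin by (cases "j \<in> S") (auto simp: card_Diff_singleton Dn_def)
          qed
          finally show "e \<le> (\<Sum>j\<in>Dn X t. I j S * real (card (?Z - {j})))" .
          show "0 \<le> \<beta>L (v t)" using \<beta>_nonneg by simp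
        qed
        also have "\<dots> \<le> ?one"
        proof -
          have "?one = (\<Sum>i\<in>?Oh. bad_one X i S)" using sum_indicator[OF finh] by simp
          then show ?thesis using 2 by simp
        qed
        finally show ?thesis using good two_nn by linarith
      qed
    qed
  qed
qed

end

section \<open>Drift of the potential\<close>

context weights begin

lemma Lo_sum_le:
  assumes a: "a \<in> U" and \<sigma>: "\<sigma> = (\<Sum>i\<in>Lo X a. q ^ i / q ^ rk (Lv a))"
  shows "(\<Sum>j\<in>Lo X a. hg j) \<le> 25/24 * (\<gamma> (Lv a) * \<sigma>)"
proof -
  have "(\<Sum>j\<in>Lo X a. hg j) \<le> (\<Sum>j\<in>Lo X a. 25/24 * (\<gamma> (Lv a) * (q ^ j / q ^ rk (Lv a))))"
  proof (rule sum_mono)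
    fix j assume j: "j \<in> Lo X a"
    then show "hg j \<le> 25/24 * (\<gamma> (Lv a) * (q ^ j / q ^ rk (Lv a)))"
      using \<gamma>_v_le[OF Lv(1)[OF a], of j] g_le_gW[OF v_cases, of j] by auto
  qed
  then show ?thesis unfolding \<sigma> by (simp add: sum_distrib_left)
qed

lemma Lo_segment: "Lo X a \<subseteq> {..<rk (Lv a)}" using less_rk_iff by auto

lemma Lo_sum_le_g:
  assumes a: "a \<in> U"
  shows "(\<Sum>j\<in>Lo X a. hg j) \<le> real n * (g a / 20000)"
proof -
  define \<sigma> where "\<sigma> = (\<Sum>i\<in>Lo X a. q ^ i / q ^ rk (Lv a))"
  have "\<sigma> \<le> real n / 27648" unfolding \<sigma>_def by (rule sum_q_le[OF Lo_segment])
  then have "\<gamma> (Lv a) * \<sigma> \<le> g a * (real n / 27648)"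
    using \<gamma>_Lv_le[OF a] gW_le_g[of a] a \<gamma>_pos[of "Lv a"] g_nonneg[of a] q_ge1
    by (intro mult_mono) (auto simp: \<sigma>_def intro!: sum_nonneg)
  then have "\<gamma> (Lv a) * \<sigma> \<le> (g a * real n) / 27648" by simp
  moreover have "0 \<le> g a * real n" using g_nonneg a by auto
  moreover have "real n * (g a / 20000) = (g a * real n) / 20000" by simp
  ultimately show ?thesis using Lo_sum_le[OF a \<sigma>_def] by linarith
qed

lemma \<beta>L_le:
  assumes a: "a \<in> U"
  shows "\<beta>L a \<le> \<gamma> (Lv a) / 2200"
proof (cases "m < Lv a")
  case True
  have "\<beta> \<le> 25/24 * gW m" using g_le_gW m_U by auto
  moreover have "gW m \<le> \<gamma> m" using gW_le_\<gamma> m_U by auto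
  moreover have "2304 * \<gamma> m \<le> \<gamma> (Lv a)"
    unfolding \<gamma>_def using True power_increasing[OF rk_mono[of m "Lv a"] q_ge1] by simp
  ultimately have "\<beta> \<le> \<gamma> (Lv a) / 2200" using \<gamma>_pos[of "Lv a"] by linarith
  then show ?thesis using True by simp
next
  case False then show ?thesis using \<gamma>_pos[of "Lv a"] by simp
qed

lemma \<beta>L_le_g: "a \<in> U \<Longrightarrow> \<beta>L a \<le> g a / 2200"
  using \<beta>L_le[of a] \<gamma>_Lv_le[of a] gW_le_g[of a] by auto

abbreviation p :: real where "p \<equiv> 1 / real n"
lemma p_bounds: "0 < p" "p \<le> 1" "p * real n = 1" using n_pos by auto

lemma card_zeros_le: "p * real (card ({..<n} - X)) \<le> 1"
proof -
  have "card ({..<n} - X) \<le> card {..<n}" by (rule card_mono) auto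
  then show ?thesis using n_pos by (simp add: field_simps)
qed

definition drift :: "nat set \<Rightarrow> real" where
  "drift X = mutE n p (\<lambda>S. if accept X S then potential (flipset X S) - potential X else 0)"

lemma mutE_linear_I:
  assumes "A \<subseteq> {..<n} - X" "i \<in> X" "X \<subseteq> {..<n}"
  shows "mutE n p (\<lambda>S. (\<Sum>j\<in>A. c j * I j S) * I i S) = p\<^sup>2 * (\<Sum>j\<in>A. c j)"
proof -
  have "mutE n p (\<lambda>S. (\<Sum>j\<in>A. c j * I j S) * I i S) = mutE n p (\<lambda>S. \<Sum>j\<in>A. c j * (I j S * I i S))"
    by (simp add: sum_distrib_right mult.assoc)
  also have "\<dots> = (\<Sum>j\<in>A. c j * p\<^sup>2)"
    unfolding mutE_sum mutE_cmult using assms by (intro sum.cong refl) (subst mutE_2, auto)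
  also have "\<dots> = p\<^sup>2 * (\<Sum>j\<in>A. c j)" by (simp only: mult.commute[of "p\<^sup>2"] sum_distrib_right)
  finally show ?thesis .
qed

lemma bad_loose_mean:
  assumes X: "X \<subseteq> {..<n}" and i: "i \<in> X"
  shows "mutE n p (\<lambda>S. bad_loose X i S * I i S) \<le> p / 12 * (hg i + \<beta>)"
proof -
  have iN: "i < n" using assms by auto
  let ?c = "of_bool (0 < v i) :: real"
  have LoN: "Lo X a \<subseteq> {..<n} - X" for a by auto
  have "(\<lambda>S. bad_loose X i S * I i S) = (\<lambda>S. 1/24 * (hg i + \<beta>) * I i S
      + ?c * ((\<Sum>j\<in>Lo X (v i). hg j * I j S) * I i S)
      + ?c * \<beta>L (v i) * ((\<Sum>j\<in>{..<n} - X. 1 * I j S) * I i S)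
      + (\<Sum>j\<in>Lo X m. hg j * I j S) * I i S)"
    by (rule ext) (simp add: bad_loose_def distrib_right)
  then have "mutE n p (\<lambda>S. bad_loose X i S * I i S) = 1/24 * (hg i + \<beta>) * p
      + ?c * (p\<^sup>2 * (\<Sum>j\<in>Lo X (v i). hg j)) + ?c * \<beta>L (v i) * (p\<^sup>2 * (\<Sum>j\<in>{..<n} - X. 1))
      + p\<^sup>2 * (\<Sum>j\<in>Lo X m. hg j)"
    by (simp only: mutE_add mutE_cmult mutE_1[OF iN] mutE_linear_I[OF LoN i X] mutE_linear_I[OF subset_refl i X])
  moreover have "p\<^sup>2 * (\<Sum>j\<in>Lo X m. hg j) \<le> p * \<beta> / 20000"
  proof -
    have "p\<^sup>2 * (\<Sum>j\<in>Lo X m. hg j) \<le> p\<^sup>2 * (real n * (\<beta> / 20000))"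
      using Lo_sum_le_g[OF m_U] by (intro mult_left_mono) auto
    then show ?thesis using n_pos by (simp add: power2_eq_square)
  qed
  moreover have "?c * (p\<^sup>2 * (\<Sum>j\<in>Lo X (v i). hg j)) \<le> p * hg i / 20000"
  proof (cases "0 < v i")
    case True
    have "p\<^sup>2 * (\<Sum>j\<in>Lo X (v i). hg j) \<le> p\<^sup>2 * (real n * (hg i / 20000))"
      using Lo_sum_le_g[OF v_U[OF iN True]] by (intro mult_left_mono) auto
    then show ?thesis using n_pos True by (simp add: power2_eq_square)
  qed (use hg_nonneg[OF iN] in simp)
  moreover have "?c * \<beta>L (v i) * (p\<^sup>2 * (\<Sum>j\<in>{..<n} - X. 1)) \<le> p * hg i / 2200"
  proof (cases "0 < v i")
    case True
    have "p * (p * real (card ({..<n} - X))) \<le> p * 1"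
      using card_zeros_le[of X] p_bounds by (intro mult_left_mono) auto
    then have "p\<^sup>2 * real (card ({..<n} - X)) \<le> p" by (simp only: power2_eq_square mult.assoc mult_1_right)
    then have "\<beta>L (v i) * (p\<^sup>2 * real (card ({..<n} - X))) \<le> hg i / 2200 * p"
      using \<beta>L_le_g[OF v_U[OF iN True]] hg_nonneg[OF iN] by (intro mult_mono) auto
    then show ?thesis using True by (simp add: mult.commute)
  qed (use hg_nonneg[OF iN] in simp)
  moreover have "0 \<le> p * hg i" "0 \<le> p * \<beta>" using hg_nonneg[OF iN] \<beta>_nonneg by auto
  moreover have "1/24 * (hg i + \<beta>) * p = 1/24 * (p * hg i) + 1/24 * (p * \<beta>)"
    "p / 12 * (hg i + \<beta>) = 1/12 * (p * hg i) + 1/12 * (p * \<beta>)" by (simp_all add: algebra_simps)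
  moreover have "E \<le> r" if "E = a + b + c + d" "d \<le> y / 20000" "b \<le> x / 20000" "c \<le> x / 2200"
      "0 \<le> x" "0 \<le> y" "a = 1/24 * x + 1/24 * y" "r = 1/12 * x + 1/12 * y"
    for E r a b c d x y :: real using that by argo
  ultimately show ?thesis by blast
qed

lemma flipset_singleton: "i \<in> X \<Longrightarrow> flipset X {i} = X - {i}" by (auto simp: flipset_def)

lemma loose_drift:
  assumes X: "X \<subseteq> {..<n}" and B: "B < card X"
  shows "drift X \<le> - (p / 4 * (\<Sum>i\<in>X. hg i + \<beta>))"
proof -
  have finX: "finite X" using X finite_subset by blast
  let ?r = "\<lambda>S. (\<Sum>i\<in>X. bad_loose X i S * I i S) - (\<Sum>i\<in>X. (hg i + \<beta>) * of_bool (S = {i}))"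
  have "drift X \<le> mutE n p ?r" unfolding drift_def
  proof (rule mutE_mono)
    fix S assume S: "S \<subseteq> {..<n}"
    show "(if accept X S then potential (flipset X S) - potential X else 0) \<le> ?r S"
    proof (cases "accept X S")
      case True
      then show ?thesis using loose_pointwise[OF X S] by (simp add: accept_def)
    next
      case False
      have "S \<noteq> {i}" if "i \<in> X" for i
      proof
        assume Si: "S = {i}"
        have "i < n" using that X by auto
        then have "excess (flipset X S) - excess X \<le> 0"
          using excess_flipset[OF finX, of S] Si that v_nonneg[of i] m_pos by simp
        moreover have "B \<le> card (flipset X S)" using B Si that finX by (simp add: flipset_singleton)
        ultimately show False using False by (simp add: accept_def)
      qed
      then have "(\<Sum>i\<in>X. (hg i + \<beta>) * of_bool (S = {i})) = 0" by (intro sum.neutral) auto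
      moreover have "0 \<le> (\<Sum>i\<in>X. bad_loose X i S * I i S)"
        using bad_loose_nonneg X by (intro sum_nonneg) auto
      ultimately show ?thesis using False by simp
    qed
  qed (use p_bounds in auto)
  also have "\<dots> = (\<Sum>i\<in>X. mutE n p (\<lambda>S. bad_loose X i S * I i S))
      - (\<Sum>i\<in>X. (hg i + \<beta>) * mutE n p (\<lambda>S. of_bool (S = {i})))"
    by (simp only: mutE_diff mutE_sum mutE_cmult)
  also have "\<dots> \<le> (\<Sum>i\<in>X. p / 12 * (hg i + \<beta>)) - (\<Sum>i\<in>X. (hg i + \<beta>) * (p / 3))"
  proof (intro diff_mono sum_mono)
    fix i assume i: "i \<in> X"
    show "mutE n p (\<lambda>S. bad_loose X i S * I i S) \<le> p / 12 * (hg i + \<beta>)" by (rule bad_loose_mean[OF X i])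
    show "(hg i + \<beta>) * (p / 3) \<le> (hg i + \<beta>) * mutE n p (\<lambda>S. of_bool (S = {i}))"
      using i X hg_nonneg[of i] \<beta>_nonneg by (intro mult_left_mono mutE_eq_singleton_ge) auto
  qed
  also have "\<dots> = (\<Sum>i\<in>X. - (p / 4 * (hg i + \<beta>)))"
    unfolding sum_subtractf[symmetric] by (intro sum.cong refl) (simp add: field_simps)
  finally show ?thesis by (simp add: sum_negf sum_distrib_left)
qed

lemma mutE_quadratic_I:
  assumes "A \<subseteq> {..<n} - X" "D \<subseteq> {..<n} - X" "t \<in> X" "X \<subseteq> {..<n}"
  shows "mutE n p (\<lambda>S. (\<Sum>j\<in>A. c j * (\<Sum>k\<in>D - {j}. I j S * I k S)) * I t S)
     = p ^ 3 * (\<Sum>j\<in>A. c j * real (card (D - {j})))"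
proof -
  have "(\<lambda>S. (\<Sum>j\<in>A. c j * (\<Sum>k\<in>D - {j}. I j S * I k S)) * I t S)
      = (\<lambda>S. \<Sum>j\<in>A. c j * (\<Sum>k\<in>D - {j}. I j S * I k S * I t S))"
    by (rule ext) (simp only: sum_distrib_right mult.assoc)
  then have "mutE n p (\<lambda>S. (\<Sum>j\<in>A. c j * (\<Sum>k\<in>D - {j}. I j S * I k S)) * I t S)
     = (\<Sum>j\<in>A. c j * (\<Sum>k\<in>D - {j}. mutE n p (\<lambda>S. I j S * I k S * I t S)))"
    by (simp only: mutE_sum mutE_cmult)
  also have "\<dots> = (\<Sum>j\<in>A. c j * (\<Sum>k\<in>D - {j}. p ^ 3))"
    by (intro sum.cong refl arg_cong2[where f="(*)"] mutE_3) (use assms in auto)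
  finally show ?thesis by (simp add: sum_distrib_left algebra_simps)
qed

lemma mutE_linear_II:
  assumes "A \<subseteq> {..<n} - X" "i \<in> X" "k \<in> X" "i \<noteq> k" "X \<subseteq> {..<n}"
  shows "mutE n p (\<lambda>S. (\<Sum>j\<in>A. c j * I j S) * (I i S * I k S)) = p ^ 3 * (\<Sum>j\<in>A. c j)"
proof -
  have "(\<lambda>S. (\<Sum>j\<in>A. c j * I j S) * (I i S * I k S)) = (\<lambda>S. \<Sum>j\<in>A. c j * (I j S * I i S * I k S))"
    by (rule ext) (simp only: sum_distrib_right mult.assoc)
  then have "mutE n p (\<lambda>S. (\<Sum>j\<in>A. c j * I j S) * (I i S * I k S)) = (\<Sum>j\<in>A. c j * mutE n p (\<lambda>S. I j S * I i S * I k S))"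
    by (simp only: mutE_sum mutE_cmult)
  also have "\<dots> = (\<Sum>j\<in>A. c j * p ^ 3)"
    by (intro sum.cong refl arg_cong2[where f="(*)"] mutE_3) (use assms in auto)
  also have "\<dots> = p ^ 3 * (\<Sum>j\<in>A. c j)" by (simp only: mult.commute[of "p ^ 3"] sum_distrib_right)
  finally show ?thesis .
qed

lemma bad_two_mean:
  assumes X: "X \<subseteq> {..<n}" and t: "t \<in> X" "0 < v t" and k: "k \<in> X" "k \<noteq> t"
  shows "mutE n p (\<lambda>S. bad_two X t S * (I t S * I k S)) \<le> p\<^sup>2 * hg t / 20"
proof -
  have tN: "t < n" "k < n" using assms by auto
  have tU: "v t \<in> U" using v_U tN t by auto
  have LoN: "Lo X a \<subseteq> {..<n} - X" for a by auto
  have tk: "t \<noteq> k" using k by auto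
  have "(\<lambda>S. bad_two X t S * (I t S * I k S)) = (\<lambda>S. 1/24 * hg t * (I t S * I k S)
      + (\<Sum>j\<in>Lo X (v t). hg j * I j S) * (I t S * I k S)
      + \<beta>L (v t) * ((\<Sum>j\<in>{..<n} - X. 1 * I j S) * (I t S * I k S)))"
    by (rule ext) (simp add: bad_two_def distrib_right)
  then have eq: "mutE n p (\<lambda>S. bad_two X t S * (I t S * I k S)) = 1/24 * hg t * p\<^sup>2
      + p ^ 3 * (\<Sum>j\<in>Lo X (v t). hg j) + \<beta>L (v t) * (p ^ 3 * (\<Sum>j\<in>{..<n} - X. 1))"
    by (simp only: mutE_add mutE_cmult mutE_2[OF tN tk] mutE_linear_II[OF LoN t(1) k(1) tk X]
      mutE_linear_II[OF subset_refl t(1) k(1) tk X])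
  have 1: "p ^ 3 * (\<Sum>j\<in>Lo X (v t). hg j) \<le> p\<^sup>2 * hg t / 20000"
  proof -
    have "p ^ 3 * (\<Sum>j\<in>Lo X (v t). hg j) \<le> p ^ 3 * (real n * (hg t / 20000))"
      using Lo_sum_le_g[OF tU] by (intro mult_left_mono) auto
    then show ?thesis using n_pos by (simp add: power2_eq_square power3_eq_cube)
  qed
  have 2: "\<beta>L (v t) * (p ^ 3 * (\<Sum>j\<in>{..<n} - X. 1)) \<le> p\<^sup>2 * hg t / 2200"
  proof -
    have "p\<^sup>2 * (p * real (card ({..<n} - X))) \<le> p\<^sup>2 * 1"
      using card_zeros_le[of X] p_bounds by (intro mult_left_mono) auto
    then have "p ^ 3 * real (card ({..<n} - X)) \<le> p\<^sup>2"
      by (simp only: power2_eq_square power3_eq_cube mult.assoc mult_1_right)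
    then have "\<beta>L (v t) * (p ^ 3 * real (card ({..<n} - X))) \<le> hg t / 2200 * p\<^sup>2"
      using \<beta>L_le_g[OF tU] hg_nonneg[OF tN(1)] by (intro mult_mono) auto
    then show ?thesis by (simp add: mult.commute)
  qed
  have "0 \<le> p\<^sup>2 * hg t" using hg_nonneg[OF tN(1)] by auto
  moreover have "1/24 * hg t * p\<^sup>2 = 1/24 * (p\<^sup>2 * hg t)" by simp
  ultimately show ?thesis using eq 1 2 by linarith
qed

lemma bad_one_mean:
  assumes X: "X \<subseteq> {..<n}" and t: "t \<in> X" "0 < v t"
    and \<sigma>: "\<sigma> = (\<Sum>i\<in>Lo X (v t). q ^ i / q ^ rk (Lv (v t)))" and M: "M = real (card (Dn X t))"
  shows "mutE n p (\<lambda>S. bad_one X t S * I t S) \<le> p ^ 3 * (\<gamma> (Lv (v t)) * (25/24 * \<sigma> * M + M\<^sup>2 / 2200))"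
proof -
  have tN: "t < n" using assms by auto
  have tU: "v t \<in> U" using v_U tN t by auto
  have LoN: "Lo X a \<subseteq> {..<n} - X" for a by auto
  have DN: "Dn X t \<subseteq> {..<n} - X" by (auto simp: Dn_def)
  have finD: "finite (Dn X t)" by (simp add: Dn_def)
  have cM: "real (card (Dn X t - {j})) \<le> M" for j
    unfolding M using finD by (simp add: card_mono)
  have "(\<lambda>S. bad_one X t S * I t S) = (\<lambda>S. (\<Sum>j\<in>Lo X (v t). hg j * (\<Sum>k\<in>Dn X t - {j}. I j S * I k S)) * I t S
      + \<beta>L (v t) * ((\<Sum>j\<in>Dn X t. 1 * (\<Sum>k\<in>Dn X t - {j}. I j S * I k S)) * I t S))"
    by (rule ext) (simp add: bad_one_def distrib_right)
  then have eq: "mutE n p (\<lambda>S. bad_one X t S * I t S) = p ^ 3 * (\<Sum>j\<in>Lo X (v t). hg j * real (card (Dn X t - {j})))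
      + \<beta>L (v t) * (p ^ 3 * (\<Sum>j\<in>Dn X t. 1 * real (card (Dn X t - {j}))))"
    by (simp only: mutE_add mutE_cmult mutE_quadratic_I[OF LoN DN t(1) X] mutE_quadratic_I[OF DN DN t(1) X])
  have "(\<Sum>j\<in>Lo X (v t). hg j * real (card (Dn X t - {j}))) \<le> (\<Sum>j\<in>Lo X (v t). hg j * M)"
    using cM hg_nonneg by (intro sum_mono mult_left_mono) auto
  also have "\<dots> = (\<Sum>j\<in>Lo X (v t). hg j) * M" by (simp add: sum_distrib_right)
  also have "\<dots> \<le> 25/24 * (\<gamma> (Lv (v t)) * \<sigma>) * M"
    using Lo_sum_le[OF tU \<sigma>] M by (intro mult_right_mono) auto
  finally have 1: "(\<Sum>j\<in>Lo X (v t). hg j * real (card (Dn X t - {j}))) \<le> 25/24 * (\<gamma> (Lv (v t)) * \<sigma>) * M" .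
  have "(\<Sum>j\<in>Dn X t. 1 * real (card (Dn X t - {j}))) \<le> (\<Sum>j\<in>Dn X t. M)" by (intro sum_mono) (simp only: mult_1 cM)
  then have "(\<Sum>j\<in>Dn X t. 1 * real (card (Dn X t - {j}))) \<le> M\<^sup>2" by (simp add: M power2_eq_square)
  then have 2: "\<beta>L (v t) * (\<Sum>j\<in>Dn X t. 1 * real (card (Dn X t - {j}))) \<le> \<gamma> (Lv (v t)) / 2200 * M\<^sup>2"
    using \<beta>L_le[OF tU] \<gamma>_pos[of "Lv (v t)"] by (intro mult_mono) (auto intro!: sum_nonneg)
  have "mutE n p (\<lambda>S. bad_one X t S * I t S) = p ^ 3 * ((\<Sum>j\<in>Lo X (v t). hg j * real (card (Dn X t - {j})))
      + \<beta>L (v t) * (\<Sum>j\<in>Dn X t. 1 * real (card (Dn X t - {j}))))"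
    unfolding eq distrib_left by (simp only: mult.left_commute)
  also have "\<dots> \<le> p ^ 3 * (25/24 * (\<gamma> (Lv (v t)) * \<sigma>) * M + \<gamma> (Lv (v t)) / 2200 * M\<^sup>2)"
    using 1 2 by (intro mult_left_mono add_mono) auto
  finally show ?thesis by (simp add: algebra_simps)
qed

lemma swap_gain:
  assumes X: "X \<subseteq> {..<n}" and t: "t \<in> X" "0 < v t"
    and \<sigma>: "\<sigma> = (\<Sum>i\<in>Lo X (v t). q ^ i / q ^ rk (Lv (v t)))" and M: "M = real (card (Dn X t))"
  defines "R \<equiv> (\<Sum>j\<in>Dn X t. hg t - hg j)"
  shows "real (card {j. j < n \<and> j \<notin> X \<and> v j = 0}) * hg t \<le> R"
    and "p * (\<gamma> (Lv (v t)) * (13824 * \<sigma>\<^sup>2)) \<le> R"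
    and "p * (\<gamma> (Lv (v t)) * (M\<^sup>2 / 48)) \<le> R"
proof -
  have tN: "t < n" using assms by auto
  have tU: "v t \<in> U" using v_U tN t by auto
  note L = Lv[OF tU]
  have finD: "finite (Dn X t)" by (simp add: Dn_def)
  have Dn: "j < n" "v j < v t" if "j \<in> Dn X t" for j using that by (auto simp: Dn_def)
  have nn: "0 \<le> hg t - hg j" if "j \<in> Dn X t" for j
    using g_mono[OF tU v_cases, of j] Dn[OF that] by auto
  let ?Z = "{j. j < n \<and> j \<notin> X \<and> v j = 0}"
  have "real (card ?Z) * hg t = (\<Sum>j\<in>?Z. hg t - hg j)" by (simp add: g_zero)
  also have "\<dots> \<le> R" unfolding R_def using finD nn t by (intro sum_mono2) (auto simp: Dn_def)
  finally show "real (card ?Z) * hg t \<le> R" .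
  have "p * (\<gamma> (Lv (v t)) * (13824 * \<sigma>\<^sup>2)) = \<gamma> (Lv (v t)) * (27648 / real n) * \<sigma>\<^sup>2 / 2" by simp
  also have "\<dots> \<le> (\<Sum>j\<in>Lo X (v t). \<gamma> (Lv (v t)) - gW (v j))"
    by (rule drop_gain[OF L(1) Lo_segment \<sigma>])
  also have "\<dots> \<le> (\<Sum>j\<in>Lo X (v t). hg t - hg j)"
  proof (rule sum_mono)
    fix j assume j: "j \<in> Lo X (v t)"
    then have jt: "v j \<le> v t" "j < n" using L(2) by auto
    have d: "0 \<le> gW (v t) - gW (v j)" using gW_mono[OF tU v_cases] jt by simp
    have "\<gamma> (Lv (v t)) - gW (v j) \<le> (gW (v t) - gW (v j)) * 1" using \<gamma>_Lv_le[OF tU] by simp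
    also have "\<dots> \<le> (gW (v t) - gW (v j)) * sl (v j)" using d sl_ge1 by (intro mult_left_mono) auto
    also have "\<dots> \<le> hg t - hg j"
      using mult_left_mono[OF sl_mono[OF jt(1)] gW_nonneg[of "v t"]] tU by (simp add: g_def algebra_simps)
    finally show "\<gamma> (Lv (v t)) - gW (v j) \<le> hg t - hg j" .
  qed
  also have "\<dots> \<le> R" unfolding R_def using finD nn L(2) by (intro sum_mono2) (auto simp: Dn_def)
  finally show "p * (\<gamma> (Lv (v t)) * (13824 * \<sigma>\<^sup>2)) \<le> R" .
  have "M\<^sup>2 / 2 \<le> (\<Sum>j\<in>Dn X t. real (rk (v t)) - real (rk (v j)))"
    unfolding M by (rule rank_gain) (auto simp: Dn_def)
  then have "p / 24 * \<gamma> (Lv (v t)) * (M\<^sup>2 / 2) \<le> p / 24 * \<gamma> (Lv (v t)) * (\<Sum>j\<in>Dn X t. real (rk (v t)) - real (rk (v j)))"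
    using \<gamma>_pos[of "Lv (v t)"] by (intro mult_left_mono) auto
  also have "\<dots> = (\<Sum>j\<in>Dn X t. \<gamma> (Lv (v t)) * (sl (v t) - sl (v j)))"
    unfolding sum_distrib_left using n_pos by (intro sum.cong refl) (simp add: sl_def field_simps)
  also have "\<dots> \<le> R" unfolding R_def
  proof (rule sum_mono)
    fix j assume j: "j \<in> Dn X t"
    have s: "0 \<le> sl (v t) - sl (v j)" using sl_mono[of "v j" "v t"] Dn[OF j] by simp
    have "\<gamma> (Lv (v t)) * (sl (v t) - sl (v j)) \<le> gW (v t) * (sl (v t) - sl (v j))"
      using s \<gamma>_Lv_le[OF tU] by (intro mult_right_mono) auto
    also have "\<dots> \<le> hg t - hg j"
      using mult_right_mono[OF gW_mono[OF tU v_cases, of j], of "sl (v j)"] Dn[OF j] sl_ge1[of "v j"]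
      by (simp add: g_def algebra_simps)
    finally show "\<gamma> (Lv (v t)) * (sl (v t) - sl (v j)) \<le> hg t - hg j" .
  qed
  finally show "p * (\<gamma> (Lv (v t)) * (M\<^sup>2 / 48)) \<le> R" by (simp add: algebra_simps)
qed

lemma quadratic_form_le: "25/24 * x * y + y\<^sup>2 / 2200 \<le> 1152 * x\<^sup>2 + y\<^sup>2 / (576::real)"
proof -
  have "0 \<le> (32 * x - 1/32 * y)\<^sup>2" by simp
  then have "2 * x * y \<le> 1024 * x\<^sup>2 + y\<^sup>2 / 1024" by (simp add: power2_eq_square algebra_simps)
  moreover have "0 \<le> x\<^sup>2" "0 \<le> y\<^sup>2" by auto
  ultimately show ?thesis by argo
qed

lemma card_light_zeros:
  assumes X: "X \<subseteq> {..<n}" and B: "card X = B"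
  shows "card {t\<in>X. 0 < v t} \<le> card {j. j < n \<and> j \<notin> X \<and> v j = 0}"
proof -
  let ?L = "{j. j < n \<and> v j = 0}"
  have finX: "finite X" using X finite_subset by blast
  have "card {..<B} \<le> card ?L" using v_light B_le by (intro card_mono) auto
  moreover have "X = {t\<in>X. 0 < v t} \<union> (X \<inter> ?L)" using X v_nonneg by force
  then have "card X = card ({t\<in>X. 0 < v t} \<union> (X \<inter> ?L))" by simp
  then have "card X = card {t\<in>X. 0 < v t} + card (X \<inter> ?L)"
    using finX by (subst (asm) card_Un_disjoint) auto
  moreover have "?L = {j. j < n \<and> j \<notin> X \<and> v j = 0} \<union> (X \<inter> ?L)" by auto
  then have "card ?L = card ({j. j < n \<and> j \<notin> X \<and> v j = 0} \<union> (X \<inter> ?L))" by simp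
  then have "card ?L = card {j. j < n \<and> j \<notin> X \<and> v j = 0} + card (X \<inter> ?L)"
    using finX by (subst (asm) card_Un_disjoint) auto
  ultimately show ?thesis using B by simp
qed

lemma potential_tight:
  assumes X: "X \<subseteq> {..<n}" and B: "card X = B"
  shows "potential X = (\<Sum>t\<in>{t\<in>X. 0 < v t}. hg t)"
proof -
  have "potential X = (\<Sum>t\<in>X. hg t)" using B by (simp add: potential_def)
  also have "\<dots> = (\<Sum>t\<in>{t\<in>X. 0 < v t}. hg t)"
  proof (rule sum.mono_neutral_right)
    show "\<forall>i\<in>X - {t\<in>X. 0 < v t}. hg i = 0"
    proof
      fix i assume "i \<in> X - {t\<in>X. 0 < v t}"
      then have "v i = 0" using X v_nonneg[of i] by auto
      then show "hg i = 0" by (simp add: g_zero)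
    qed
  qed (use X finite_subset in auto)
  finally show ?thesis .
qed

lemma tight_drift:
  assumes X: "X \<subseteq> {..<n}" and B: "card X = B"
  shows "drift X \<le> - (p\<^sup>2 / 12 * real (card {t\<in>X. 0 < v t}) * potential X)"
proof -
  define Xh where "Xh = {t\<in>X. 0 < v t}"
  define h where "h = real (card Xh)"
  have finX: "finite X" using X finite_subset by blast
  have finh: "finite Xh" by (simp add: Xh_def finX)
  let ?two = "\<lambda>S. \<Sum>t\<in>Xh. \<Sum>t'\<in>Xh - {t}. bad_two X t S * (I t S * I t' S)"
  let ?one = "\<lambda>S. \<Sum>t\<in>Xh. bad_one X t S * I t S"
  let ?good = "\<lambda>S. \<Sum>t\<in>Xh. \<Sum>j\<in>Dn X t. (hg t - hg j) * of_bool (S = {t, j})"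
  have "drift X \<le> mutE n p (\<lambda>S. ?two S + ?one S - ?good S)" unfolding drift_def
  proof (rule mutE_mono)
    fix S assume S: "S \<subseteq> {..<n}"
    have finS: "finite S" using S finite_subset by blast
    show "(if accept X S then potential (flipset X S) - potential X else 0) \<le> ?two S + ?one S - ?good S"
    proof (cases "accept X S")
      case True
      then show ?thesis using tight_pointwise[OF X B S True Xh_def] by simp
    next
      case False
      have ne: "S \<noteq> {t, j}" if "t \<in> Xh" "j \<in> Dn X t" for t j
      proof
        assume Sj: "S = {t, j}"
        have tj: "t \<in> X" "j \<notin> X" "t \<noteq> j" "v j < v t" using that by (auto simp: Xh_def Dn_def)
        have OZ: "X \<inter> S = {t}" "S - X = {j}" using Sj tj by auto
        then have "excess (flipset X S) \<le> excess X" using excess_flipset[OF finX finS] tj by simp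
        moreover have "card (flipset X S) = B" using flipset_card[OF finX finS] OZ B by simp
        ultimately show False using False by (simp add: accept_def)
      qed
      have "?good S = 0" by (intro sum.neutral ballI) (use ne in auto)
      moreover have "0 \<le> ?two S" "0 \<le> ?one S"
        using X by (auto simp: Xh_def intro!: sum_nonneg mult_nonneg_nonneg bad_two_nonneg bad_one_nonneg)
      ultimately show ?thesis using False by simp
    qed
  qed (use p_bounds in auto)
  also have "\<dots> = (\<Sum>t\<in>Xh. (\<Sum>t'\<in>Xh - {t}. mutE n p (\<lambda>S. bad_two X t S * (I t S * I t' S)))
      + mutE n p (\<lambda>S. bad_one X t S * I t S)
      - (\<Sum>j\<in>Dn X t. (hg t - hg j) * mutE n p (\<lambda>S. of_bool (S = {t, j}))))"
    by (simp only: mutE_diff mutE_add mutE_sum mutE_cmult sum.distrib sum_subtractf)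
  also have "\<dots> \<le> (\<Sum>t\<in>Xh. - (p\<^sup>2 / 12 * h * hg t))"
  proof (rule sum_mono)
    fix t assume "t \<in> Xh"
    then have t: "t \<in> X" "0 < v t" "t < n" using X by (auto simp: Xh_def)
    have tU: "v t \<in> U" using v_U t by auto
    define \<sigma> where "\<sigma> = (\<Sum>i\<in>Lo X (v t). q ^ i / q ^ rk (Lv (v t)))"
    define M where "M = real (card (Dn X t))"
    define R where "R = (\<Sum>j\<in>Dn X t. hg t - hg j)"
    define lam where "lam = \<gamma> (Lv (v t))"
    define z where "z = real (card {j. j < n \<and> j \<notin> X \<and> v j = 0})"
    have lam: "0 \<le> lam" using \<gamma>_pos[of "Lv (v t)"] by (simp add: lam_def)
    have hz: "h \<le> z" using card_light_zeros[OF X B] by (simp add: h_def z_def Xh_def)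
    have "(\<Sum>t'\<in>Xh - {t}. mutE n p (\<lambda>S. bad_two X t S * (I t S * I t' S))) \<le> (\<Sum>t'\<in>Xh - {t}. p\<^sup>2 * hg t / 20)"
      by (rule sum_mono, rule bad_two_mean[OF X t(1,2)]) (auto simp: Xh_def)
    also have "\<dots> \<le> (\<Sum>t'\<in>Xh. p\<^sup>2 * hg t / 20)"
      using finh hg_nonneg[OF t(3)] by (intro sum_mono2) auto
    finally have 1: "(\<Sum>t'\<in>Xh - {t}. mutE n p (\<lambda>S. bad_two X t S * (I t S * I t' S))) \<le> p\<^sup>2 * (h * hg t / 20)"
      by (simp add: h_def mult_ac)
    have 2: "mutE n p (\<lambda>S. bad_one X t S * I t S) \<le> p ^ 3 * (lam * (25/24 * \<sigma> * M + M\<^sup>2 / 2200))"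
      unfolding lam_def by (rule bad_one_mean[OF X t(1,2) \<sigma>_def M_def])
    have "(\<Sum>j\<in>Dn X t. (hg t - hg j) * (p\<^sup>2 / 3)) \<le> (\<Sum>j\<in>Dn X t. (hg t - hg j) * mutE n p (\<lambda>S. of_bool (S = {t, j})))"
      using t(3) g_mono[OF tU v_cases]
      by (intro sum_mono mult_left_mono mutE_eq_pair_ge) (auto simp: Dn_def)
    moreover have "(\<Sum>j\<in>Dn X t. (hg t - hg j) * (p\<^sup>2 / 3)) = p\<^sup>2 * (R / 3)"
      unfolding R_def sum_distrib_right[symmetric] by simp
    ultimately have 3: "p\<^sup>2 * (R / 3) \<le> (\<Sum>j\<in>Dn X t. (hg t - hg j) * mutE n p (\<lambda>S. of_bool (S = {t, j})))"
      by simp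
    note G = swap_gain[OF X t(1,2) \<sigma>_def M_def, folded R_def lam_def z_def]
    have "p * (lam * (25/24 * \<sigma> * M + M\<^sup>2 / 2200)) \<le> p * (lam * (1152 * \<sigma>\<^sup>2 + M\<^sup>2 / 576))"
      using lam quadratic_form_le[of \<sigma> M] by (intro mult_left_mono) auto
    also have "\<dots> = 1/12 * (p * (lam * (13824 * \<sigma>\<^sup>2))) + 1/12 * (p * (lam * (M\<^sup>2 / 48)))"
      by (simp add: algebra_simps)
    also have "\<dots> \<le> R / 6" using G(2,3) by argo
    finally have 4: "p * (lam * (25/24 * \<sigma> * M + M\<^sup>2 / 2200)) \<le> R / 6" .
    have "h * hg t \<le> z * hg t" using hz hg_nonneg[OF t(3)] by (intro mult_right_mono) auto
    then have 5: "h * hg t \<le> R" using G(1) by simp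
    have "0 \<le> h * hg t" using hg_nonneg[OF t(3)] by (simp add: h_def)
    then have "h * hg t / 20 + R / 6 - R / 3 \<le> - (h * hg t / 12)" using 5 by argo
    then have "p\<^sup>2 * (h * hg t / 20 + R / 6 - R / 3) \<le> p\<^sup>2 * (- (h * hg t / 12))"
      by (intro mult_left_mono) auto
    then have 6: "p\<^sup>2 * (h * hg t / 20) + p\<^sup>2 * (R / 6) - p\<^sup>2 * (R / 3) \<le> - (p\<^sup>2 / 12 * h * hg t)"
      by (simp add: algebra_simps)
    have "p\<^sup>2 * (p * (lam * (25/24 * \<sigma> * M + M\<^sup>2 / 2200))) \<le> p\<^sup>2 * (R / 6)"
      using 4 by (intro mult_left_mono) auto
    then have "p ^ 3 * (lam * (25/24 * \<sigma> * M + M\<^sup>2 / 2200)) \<le> p\<^sup>2 * (R / 6)"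
      by (simp only: power2_eq_square power3_eq_cube mult.assoc)
    then show "(\<Sum>t'\<in>Xh - {t}. mutE n p (\<lambda>S. bad_two X t S * (I t S * I t' S)))
      + mutE n p (\<lambda>S. bad_one X t S * I t S)
      - (\<Sum>j\<in>Dn X t. (hg t - hg j) * mutE n p (\<lambda>S. of_bool (S = {t, j}))) \<le> - (p\<^sup>2 / 12 * h * hg t)"
      using 1 2 3 6 by linarith
  qed
  also have "\<dots> = - (p\<^sup>2 / 12 * h * (\<Sum>t\<in>Xh. hg t))" by (simp add: sum_negf sum_distrib_left)
  also have "(\<Sum>t\<in>Xh. hg t) = potential X" using potential_tight[OF X B] by (simp add: Xh_def)
  finally show ?thesis by (simp add: h_def Xh_def)
qed

lemma potential_le_sum:
  assumes "X \<subseteq> {..<n}" "B \<le> card X"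
  shows "0 \<le> potential X" "potential X \<le> (\<Sum>i\<in>X. hg i + \<beta>)"
proof -
  have "0 \<le> (\<Sum>i\<in>X. hg i)" using assms hg_nonneg by (intro sum_nonneg) auto
  moreover have "0 \<le> \<beta> * (real (card X) - real B)" using \<beta>_nonneg assms by simp
  ultimately show "0 \<le> potential X" by (simp add: potential_def)
  have "0 \<le> \<beta> * real B" using \<beta>_nonneg by simp
  then show "potential X \<le> (\<Sum>i\<in>X. hg i + \<beta>)" by (simp add: potential_def sum.distrib algebra_simps)
qed

lemma drift_le:
  assumes X: "X \<subseteq> {..<n}" and B: "B \<le> card X"
  shows "drift X \<le> - (p\<^sup>2 * (potential X)\<^sup>2 / (12 * coeff_bound))"
proof -
  have finX: "finite X" using X finite_subset by blast
  have Kp: "0 < coeff_bound" using coeff_bound_ge1 by simp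
  note G = potential_le_sum[OF X B]
  show ?thesis
  proof (cases "card X = B")
    case True
    let ?Xh = "{t\<in>X. 0 < v t}"
    have "potential X = (\<Sum>t\<in>?Xh. hg t)" by (rule potential_tight[OF X True])
    also have "\<dots> \<le> (\<Sum>t\<in>?Xh. coeff_bound)" using X g_le_coeff_bound[OF v_cases] by (intro sum_mono) auto
    finally have "potential X \<le> real (card ?Xh) * coeff_bound" by simp
    then have "potential X * potential X \<le> real (card ?Xh) * coeff_bound * potential X" using G by (intro mult_right_mono) auto
    then have "(potential X)\<^sup>2 / coeff_bound \<le> real (card ?Xh) * potential X" using Kp by (simp add: field_simps power2_eq_square)
    then have "p\<^sup>2 / 12 * ((potential X)\<^sup>2 / coeff_bound) \<le> p\<^sup>2 / 12 * (real (card ?Xh) * potential X)"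
      by (intro mult_left_mono) auto
    then show ?thesis using tight_drift[OF X True] by (simp add: mult.assoc)
  next
    case False
    let ?W = "\<Sum>i\<in>X. hg i + \<beta>"
    have "?W \<le> (\<Sum>i\<in>X. 2 * coeff_bound)"
    proof (rule sum_mono)
      fix i assume "i \<in> X"
      then show "hg i + \<beta> \<le> 2 * coeff_bound" using X g_le_coeff_bound[OF v_cases, of i] g_le_coeff_bound[of m] m_U by auto
    qed
    also have "\<dots> \<le> real n * (2 * coeff_bound)"
      using card_mono[OF _ X] Kp by (simp add: mult_right_mono)
    finally have W: "p * ?W \<le> 2 * coeff_bound" using n_pos by (simp add: field_simps)
    have "p * potential X * (p * potential X) \<le> p * ?W * (p * ?W)" using G p_bounds by (intro mult_mono) auto
    also have "\<dots> \<le> 2 * coeff_bound * (p * ?W)" using W G p_bounds by (intro mult_right_mono) auto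
    finally have "p\<^sup>2 * (potential X)\<^sup>2 \<le> 2 * coeff_bound * (p * ?W)" by (simp only: power2_eq_square mult_ac)
    also have "\<dots> \<le> 3 * coeff_bound * (p * ?W)" using G Kp p_bounds by (intro mult_right_mono) auto
    finally have "p\<^sup>2 * (potential X)\<^sup>2 / (12 * coeff_bound) \<le> 3 * coeff_bound * (p * ?W) / (12 * coeff_bound)"
      using Kp by (intro divide_right_mono) auto
    also have "\<dots> = p / 4 * ?W" using Kp by simp
    finally have "p\<^sup>2 * (potential X)\<^sup>2 / (12 * coeff_bound) \<le> p / 4 * ?W" .
    then show ?thesis using loose_drift[OF X] B False by simp
  qed
qed

end

section \<open>The Lyapunov function\<close>

definition bits :: "nat \<Rightarrow> bool list \<Rightarrow> nat set" where "bits n x = {i. i < n \<and> x ! i}"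

lemma sum_bval: "(\<Sum>i=1..n. f i * bval (x ! (i - 1))) = (\<Sum>i\<in>bits n x. f (Suc i))"
proof -
  have "(\<Sum>i=1..n. f i * bval (x ! (i - 1))) = (\<Sum>i<n. f (Suc i) * bval (x ! i))"
    using sum.atLeast1_atMost_eq[of "\<lambda>i. f i * bval (x ! (i - 1))" n] by simp
  also have "\<dots> = (\<Sum>i<n. if x ! i then f (Suc i) else 0)" by (rule sum.cong) (auto simp: bval_def)
  also have "\<dots> = (\<Sum>i\<in>{i\<in>{..<n}. x ! i}. f (Suc i))" by (rule sum.inter_filter[symmetric]) simp
  finally show ?thesis by (simp add: bits_def)
qed

lemma ones_bits: "ones n x = real (card (bits n x))"
  using sum_bval[of "\<lambda>_. 1" x n] by (simp add: ones_def)

lemma bits_sub: "bits n x \<subseteq> {..<n}" by (auto simp: bits_def)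
lemma finite_bits_set: "finite (bits n x)" by (simp add: bits_def)

definition psi :: "real \<Rightarrow> real" where "psi s = (if s < 1 then 0 else 2 - 1 / s)"

lemma psi_bounds: "0 \<le> psi s" "psi s \<le> 2"
proof -
  have "1 / s \<le> 2" if "1 \<le> s" using that by (simp add: field_simps)
  then show "0 \<le> psi s" "psi s \<le> 2" by (auto simp: psi_def)
qed

lemma psi_tangent:
  assumes "1 \<le> s" "0 \<le> s'"
  shows "psi s' - psi s \<le> (s' - s) / s\<^sup>2"
proof (cases "s' < 1")
  case True
  have "1 / s \<le> 1" "0 \<le> s' / s\<^sup>2" using assms by auto
  moreover have "(s' - s) / s\<^sup>2 = s' / s\<^sup>2 - 1 / s"
    using assms by (simp add: diff_divide_distrib power2_eq_square)
  moreover have "psi s' = 0" "psi s = 2 - 1 / s" using True assms by (auto simp: psi_def)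
  ultimately show ?thesis by linarith
next
  case False
  have "(s' - s) / s\<^sup>2 - (1 / s - 1 / s') = (s' - s)\<^sup>2 / (s\<^sup>2 * s')"
    using False assms by (simp add: field_simps power2_eq_square)
  moreover have "0 \<le> (s' - s)\<^sup>2 / (s\<^sup>2 * s')" using False by simp
  moreover have "psi s' = 2 - 1 / s'" "psi s = 2 - 1 / s" using False assms by (auto simp: psi_def)
  ultimately show ?thesis by linarith
qed

context weights begin

lemma potential_ge1:
  assumes "X \<subseteq> {..<n}" "B \<le> card X" "\<not> (card X = B \<and> (\<forall>i\<in>X. v i = 0))"
  shows "1 \<le> potential X"
proof (cases "card X = B")
  case True
  then obtain i where i: "i \<in> X" "v i \<noteq> 0" using assms by auto
  then have "v i \<in> U" using v_cases[of i] assms by auto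
  then have "1 \<le> hg i" by (rule g_ge1)
  also have "\<dots> \<le> (\<Sum>i\<in>X. hg i)"
    using i assms hg_nonneg finite_subset[OF assms(1)] by (intro member_le_sum) auto
  finally show ?thesis using True by (simp add: potential_def)
next
  case False
  then have "1 * 1 \<le> \<beta> * (real (card X) - real B)"
    using assms(2) g_ge1[OF m_U] by (intro mult_mono) auto
  moreover have "0 \<le> (\<Sum>i\<in>X. hg i)" using assms hg_nonneg by (intro sum_nonneg) auto
  ultimately show ?thesis by (simp add: potential_def)
qed

definition lyapunov :: "nat set \<Rightarrow> real" where
  "lyapunov X = (if B \<le> card X then 12 * coeff_bound * (real n)\<^sup>2 * psi (potential X)
     else 24 * coeff_bound * (real n)\<^sup>2 + 3 * real n * (real B - real (card X)))"

lemma lyapunov_feasible_le: "B \<le> card X \<Longrightarrow> lyapunov X \<le> 24 * coeff_bound * (real n)\<^sup>2"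
proof -
  assume "B \<le> card X"
  moreover have "12 * coeff_bound * (real n)\<^sup>2 * psi (potential X) \<le> 12 * coeff_bound * (real n)\<^sup>2 * 2"
    using psi_bounds coeff_bound_ge1 by (intro mult_left_mono) auto
  ultimately show ?thesis by (simp add: lyapunov_def)
qed

lemma lyapunov_bounds: "0 \<le> lyapunov X" "lyapunov X \<le> (24 * coeff_bound + 3) * (real n)\<^sup>2"
proof -
  have coeff_bound: "0 \<le> coeff_bound" using coeff_bound_ge1 by simp
  show "0 \<le> lyapunov X" using coeff_bound psi_bounds by (auto simp: lyapunov_def intro!: add_nonneg_nonneg mult_nonneg_nonneg)
  have "3 * real n * (real B - real (card X)) \<le> 3 * real n * real n"
    using B_le by (intro mult_left_mono) auto
  moreover have "(24 * coeff_bound + 3) * (real n)\<^sup>2 = 24 * coeff_bound * (real n)\<^sup>2 + 3 * real n * real n"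
    by (simp add: distrib_right power2_eq_square)
  moreover have "0 \<le> 3 * real n * real n" by simp
  ultimately show "lyapunov X \<le> (24 * coeff_bound + 3) * (real n)\<^sup>2"
    using lyapunov_feasible_le[of X] by (cases "B \<le> card X") (linarith, simp add: lyapunov_def)
qed

lemma feasible_step:
  assumes X: "X \<subseteq> {..<n}" "B \<le> card X" "1 \<le> potential X"
  shows "mutE n p (\<lambda>S. lyapunov (if accept X S then flipset X S else X)) \<le> lyapunov X - 1"
proof -
  let ?c = "12 * coeff_bound * (real n)\<^sup>2"
  have c: "0 < ?c" using coeff_bound_ge1 n_pos by simp
  have "mutE n p (\<lambda>S. lyapunov (if accept X S then flipset X S else X))
     \<le> mutE n p (\<lambda>S. lyapunov X + ?c / (potential X)\<^sup>2 * (if accept X S then potential (flipset X S) - potential X else 0))"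
  proof (rule mutE_mono)
    fix S assume S: "S \<subseteq> {..<n}"
    show "lyapunov (if accept X S then flipset X S else X)
      \<le> lyapunov X + ?c / (potential X)\<^sup>2 * (if accept X S then potential (flipset X S) - potential X else 0)"
    proof (cases "accept X S")
      case True
      then have Y: "B \<le> card (flipset X S)" "flipset X S \<subseteq> {..<n}"
        using X S by (auto simp: accept_def flipset_def)
      have "?c * (psi (potential (flipset X S)) - psi (potential X)) \<le> ?c * ((potential (flipset X S) - potential X) / (potential X)\<^sup>2)"
        using c psi_tangent[OF X(3) potential_le_sum(1)[OF Y(2,1)]] by (intro mult_left_mono) auto
      then show ?thesis using True X Y by (simp add: lyapunov_def algebra_simps)
    qed simp
  qed (use p_bounds in auto)
  also have "\<dots> = lyapunov X + ?c / (potential X)\<^sup>2 * drift X"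
    unfolding drift_def by (simp only: mutE_add mutE_const mutE_cmult)
  also have "?c / (potential X)\<^sup>2 * drift X \<le> ?c / (potential X)\<^sup>2 * - (p\<^sup>2 * (potential X)\<^sup>2 / (12 * coeff_bound))"
    using drift_le[OF X(1,2)] c by (intro mult_left_mono) auto
  also have "?c / (potential X)\<^sup>2 * - (p\<^sup>2 * (potential X)\<^sup>2 / (12 * coeff_bound)) = - 1"
    using X(3) coeff_bound_ge1 n_pos by (simp add: field_simps)
  finally show ?thesis by simp
qed

lemma infeasible_step:
  assumes X: "X \<subseteq> {..<n}" "card X < B"
    and up: "\<And>S. S \<subseteq> {..<n} \<Longrightarrow> ok S \<Longrightarrow> card X \<le> card (flipset X S)"
    and one: "\<And>i. i < n \<Longrightarrow> i \<notin> X \<Longrightarrow> ok {i}"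
  shows "mutE n p (\<lambda>S. lyapunov (if ok S then flipset X S else X)) \<le> lyapunov X - 1"
proof -
  have finX: "finite X" using X finite_subset by blast
  have "\<not> {..<n} \<subseteq> X" using card_mono[OF finX, of "{..<n}"] X(2) B_le by auto
  then obtain i where i: "i < n" "i \<notin> X" by auto
  have le: "lyapunov Y + 3 * real n * d \<le> lyapunov X" if "real (card X) + d \<le> real (card Y)" "0 \<le> d" "d \<le> 1" for Y d
  proof (cases "B \<le> card Y")
    case True
    have "3 * real n * d \<le> 3 * real n * (real B - real (card X))"
      using that X by (intro mult_left_mono) auto
    then show ?thesis using lyapunov_feasible_le[OF True] X by (simp add: lyapunov_def)
  next
    case False
    have "3 * real n * (real B - real (card Y)) + 3 * real n * d = 3 * real n * (real B - real (card Y) + d)"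
      by (simp add: algebra_simps)
    also have "\<dots> \<le> 3 * real n * (real B - real (card X))"
      using that by (intro mult_left_mono) auto
    finally show ?thesis using False X by (simp add: lyapunov_def)
  qed
  have "mutE n p (\<lambda>S. lyapunov (if ok S then flipset X S else X)) \<le> mutE n p (\<lambda>S. lyapunov X - 3 * real n * of_bool (S = {i}))"
  proof (rule mutE_mono)
    fix S assume S: "S \<subseteq> {..<n}"
    show "lyapunov (if ok S then flipset X S else X) \<le> lyapunov X - 3 * real n * of_bool (S = {i})"
    proof (cases "S = {i}")
      case True
      have "flipset X S = insert i X" using True i by (auto simp: flipset_def)
      then have "card (flipset X S) = Suc (card X)" using i finX by simp
      then show ?thesis using le[of 1 "flipset X S"] True one[OF i] by simp
    next
      case False
      then show ?thesis using le[of 0 "flipset X S"] up[OF S] by simp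
    qed
  qed (use p_bounds in auto)
  also have "\<dots> = lyapunov X - 3 * real n * mutE n p (\<lambda>S. of_bool (S = {i}))"
    by (simp only: mutE_diff mutE_const mutE_cmult)
  also have "\<dots> \<le> lyapunov X - 3 * real n * (p / 3)"
    using mutE_eq_singleton_ge[OF i(1)] by (intro diff_left_mono mult_left_mono) auto
  finally show ?thesis using n_pos by simp
qed

end

lemma ea_drift:
  fixes n B :: nat and w :: "nat \<Rightarrow> real"
  assumes n: "1 \<le> n" and w1: "0 < w 1" and mono: "\<And>i j. 1 \<le> i \<Longrightarrow> i \<le> j \<Longrightarrow> j \<le> n \<Longrightarrow> w i \<le> w j"
    and B: "1 \<le> B" "B \<le> n" and wB: "w 1 = w B"
  obtains V where "\<And>x. length x = n \<Longrightarrow> 0 \<le> V x"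
    "\<And>x. length x = n \<Longrightarrow> V x \<le> (24 * coeff_bound + 3) * (real n)\<^sup>2"
    "\<And>x. length x = n \<Longrightarrow> \<not> optimal n w B x \<Longrightarrow>
      measure_pmf.expectation (ea_step (fpen n w B) n x) V \<le> V x - 1"
proof -
  define m where "m = w 1"
  define v where "v i = w (Suc i) - m" for i
  have wge: "m \<le> w (Suc i)" if "i < n" for i using mono[of 1 "Suc i"] that by (auto simp: m_def)
  interpret weights n v m B
  proof
    show "v i \<le> v j" if "i \<le> j" "j < n" for i j using mono[of "Suc i" "Suc j"] that by (simp add: v_def)
    show "v i = 0" if "i < B" for i
      using mono[of 1 "Suc i"] mono[of "Suc i" B] wB that B by (simp add: v_def m_def)
  qed (use assms in \<open>auto simp: m_def\<close>)
  let ?X = "bits n"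
  let ?f = "fpen n w B"
  have fobj: "fobj n w x = excess (?X x) + m * real B" for x
    using sum_bval[of w x n] by (simp add: fobj_def excess_def v_def sum_subtractf algebra_simps)
  have fobj_eq: "fobj n w x = (\<Sum>i\<in>?X x. w (Suc i))" for x using sum_bval[of w x n] by (simp add: fobj_def)
  have fobj0: "0 \<le> fobj n w x" for x
    unfolding fobj_eq using wge m_pos bits_sub[of n x] by (intro sum_nonneg) force
  have cardn: "card (?X x) \<le> n" for x using card_mono[OF _ bits_sub[of n x]] by simp
  have wn: "0 < w n" using mono[of 1 n] w1 n by auto
  have fobj1: "fobj n w x \<le> real n * w n" for x
  proof -
    have "fobj n w x \<le> (\<Sum>i\<in>?X x. w n)"
      unfolding fobj_eq using mono bits_sub[of n x] by (intro sum_mono) auto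
    also have "\<dots> \<le> real n * w n" using cardn[of x] wn by (simp add: mult_right_mono)
    finally show ?thesis .
  qed
  have pen: "?f x = fobj n w x + max 0 (real B - real (card (?X x))) * (real n * w n + 1)" for x
    by (simp add: fpen_def ones_bits)
  have Q: "0 < real n * w n + 1" using wn n by (simp add: add_pos_pos)
  have f_less: "?f y < ?f x" if "card (?X x) < card (?X y)" "card (?X x) < B" for x y
  proof -
    have "max 0 (real B - real (card (?X y))) + 1 \<le> real B - real (card (?X x))" using that by auto
    then have "(max 0 (real B - real (card (?X y))) + 1) * (real n * w n + 1)
       \<le> (real B - real (card (?X x))) * (real n * w n + 1)" using Q by (intro mult_right_mono) auto
    moreover have "max 0 (real B - real (card (?X x))) = real B - real (card (?X x))" using that by simp
    ultimately show ?thesis unfolding pen using fobj0[of x] fobj1[of y] by (simp add: distrib_right)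
  qed
  have bits_flip: "?X (flip x S) = flipset (?X x) S" if "length x = n" "S \<subseteq> {..<n}" for x S
    using that by (auto simp: bits_def flip_def flipset_def)
  have acc: "?f (flip x S) \<le> ?f x \<longleftrightarrow> accept (?X x) S"
    if x: "length x = n" "B \<le> card (?X x)" and S: "S \<subseteq> {..<n}" for x S
  proof (cases "B \<le> card (?X (flip x S))")
    case True
    then show ?thesis using x by (simp add: pen fobj accept_def bits_flip[OF x(1) S])
  next
    case False
    then show ?thesis using f_less[of "flip x S" x] x by (simp add: accept_def bits_flip[OF x(1) S, symmetric])
  qed
  have E: "measure_pmf.expectation (ea_step ?f n x) (\<lambda>y. lyapunov (?X y))
     = mutE n p (\<lambda>S. lyapunov (if ?f (flip x S) \<le> ?f x then flipset (?X x) S else ?X x))" if x: "length x = n" for x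
  proof -
    have "measure_pmf.expectation (ea_step ?f n x) (\<lambda>y. lyapunov (?X y))
      = mutE n p (\<lambda>S. lyapunov (?X (if ?f (flip x S) \<le> ?f x then flip x S else x)))"
      using expectation_mutate[of p x "\<lambda>y. lyapunov (?X (if ?f y \<le> ?f x then y else x))"] p_bounds x
      by (simp add: ea_step_def)
    also have "\<dots> = mutE n p (\<lambda>S. lyapunov (if ?f (flip x S) \<le> ?f x then flipset (?X x) S else ?X x))"
      unfolding mutE_def by (intro sum.cong refl) (use bits_flip[OF x] in auto)
    finally show ?thesis .
  qed
  have opt: "1 \<le> potential (?X x)" if x: "length x = n" "B \<le> card (?X x)" "\<not> optimal n w B x" for x
  proof (rule potential_ge1[OF bits_sub x(2)], rule notI)
    assume 0: "card (?X x) = B \<and> (\<forall>i\<in>?X x. v i = 0)"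
    have "fobj n w x \<le> fobj n w y" if "feasible n B y" for y
    proof -
      have "real B \<le> real (card (?X y))" using that by (simp add: feasible_def ones_bits)
      moreover have "0 \<le> (\<Sum>i\<in>?X y. v i)" using v_nonneg bits_sub[of n y] by (intro sum_nonneg) auto
      ultimately have "0 \<le> excess (?X y)" using m_pos by (simp add: excess_def)
      moreover have "excess (?X x) = 0" using 0 by (simp add: excess_def)
      ultimately show ?thesis by (simp add: fobj)
    qed
    moreover have "feasible n B x" using x by (simp add: feasible_def ones_bits)
    ultimately show False using x(3) by (auto simp: optimal_def)
  qed
  show ?thesis
  proof (rule that[of "\<lambda>x. lyapunov (?X x)"])
    fix x :: "bool list" assume x: "length x = n"
    show "0 \<le> lyapunov (?X x)" "lyapunov (?X x) \<le> (24 * coeff_bound + 3) * (real n)\<^sup>2" by (rule lyapunov_bounds)+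
    assume no: "\<not> optimal n w B x"
    show "measure_pmf.expectation (ea_step ?f n x) (\<lambda>y. lyapunov (?X y)) \<le> lyapunov (?X x) - 1"
    proof (cases "B \<le> card (?X x)")
      case True
      have "measure_pmf.expectation (ea_step ?f n x) (\<lambda>y. lyapunov (?X y))
         = mutE n p (\<lambda>S. lyapunov (if accept (?X x) S then flipset (?X x) S else ?X x))"
        unfolding E[OF x] mutE_def by (intro sum.cong refl) (use acc[OF x True] in auto)
      then show ?thesis using feasible_step[OF bits_sub True opt[OF x True no]] by simp
    next
      case False
      show ?thesis unfolding E[OF x]
      proof (rule infeasible_step[OF bits_sub])
        show "card (?X x) < B" using False by simp
        show "card (?X x) \<le> card (flipset (?X x) S)" if "S \<subseteq> {..<n}" "?f (flip x S) \<le> ?f x" for S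
          using f_less[of "flip x S" x] that False by (force simp: bits_flip[OF x])
        fix i assume i: "i < n" "i \<notin> ?X x"
        then have "flipset (?X x) {i} = insert i (?X x)" by (auto simp: flipset_def)
        then have "card (?X (flip x {i})) = Suc (card (?X x))"
          using bits_flip[OF x, of "{i}"] i finite_bits_set by simp
        then show "?f (flip x {i}) \<le> ?f x" using f_less[of x "flip x {i}"] False by simp
      qed
    qed
  qed
qed

theorem theorem6:
  shows "(\<exists>C::real. \<forall>(n::nat) (w::nat \<Rightarrow> real) (B::nat).
            1 \<le> n \<and> 0 < w 1 \<and> (\<forall>i j. 1 \<le> i \<and> i \<le> j \<and> j \<le> n \<longrightarrow> w i \<le> w j)
            \<and> 1 \<le> B \<and> B \<le> n \<and> w 1 = w B
            \<longrightarrow> expected_T n w B \<le> ennreal (C * real n ^ 2))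
       \<and> (\<forall>c::real. 0 < c \<longrightarrow> (\<exists>C::real. \<forall>(n::nat) (w::nat \<Rightarrow> real) (B::nat).
            1 \<le> n \<and> 0 < w 1 \<and> (\<forall>i j. 1 \<le> i \<and> i \<le> j \<and> j \<le> n \<longrightarrow> w i \<le> w j)
            \<and> 1 \<le> B \<and> B \<le> n \<and> w 1 = w B
            \<longrightarrow> T_gt n w B (nat \<lfloor>C * real n ^ 2 * ln (real n)\<rfloor>) \<le> C * real n powr (- c)))"
proof (intro conjI allI impI)
  define C where "C = 24 * coeff_bound + 3"
  have coeff_bound: "0 < coeff_bound" by (simp add: coeff_bound_def)
  then have C: "1 \<le> C" by (simp add: C_def)
  have bound: "expected_T n w B \<le> ennreal (C * real n ^ 2) \<and>
      (\<forall>t. T_gt n w B t \<le> C * real n ^ 2 * exp (- real t / (C * real n ^ 2)))"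
    if H: "1 \<le> n \<and> 0 < w 1 \<and> (\<forall>i j. 1 \<le> i \<and> i \<le> j \<and> j \<le> n \<longrightarrow> w i \<le> w j)
            \<and> 1 \<le> B \<and> B \<le> n \<and> w 1 = w B" for n B and w :: "nat \<Rightarrow> real"
  proof -
    obtain V where V: "\<And>x. length x = n \<Longrightarrow> 0 \<le> V x"
      "\<And>x. length x = n \<Longrightarrow> V x \<le> C * real n ^ 2"
      "\<And>x. length x = n \<Longrightarrow> \<not> optimal n w B x \<Longrightarrow>
        measure_pmf.expectation (ea_step (fpen n w B) n x) V \<le> V x - 1"
      using ea_drift[of n w B] H unfolding C_def by metis
    have "1 * 1 \<le> C * real n ^ 2" using C H by (intro mult_mono one_le_power) auto
    then have M: "1 \<le> C * real n ^ 2" by simp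
    show ?thesis using runtime_of_drift[OF V(1,2) M V(3)] by blast
  qed
  show "\<exists>C::real. \<forall>(n::nat) (w::nat \<Rightarrow> real) (B::nat).
            1 \<le> n \<and> 0 < w 1 \<and> (\<forall>i j. 1 \<le> i \<and> i \<le> j \<and> j \<le> n \<longrightarrow> w i \<le> w j)
            \<and> 1 \<le> B \<and> B \<le> n \<and> w 1 = w B
            \<longrightarrow> expected_T n w B \<le> ennreal (C * real n ^ 2)"
    using bound by blast
  fix c :: real assume c: "0 < c"
  show "\<exists>C::real. \<forall>(n::nat) (w::nat \<Rightarrow> real) (B::nat).
            1 \<le> n \<and> 0 < w 1 \<and> (\<forall>i j. 1 \<le> i \<and> i \<le> j \<and> j \<le> n \<longrightarrow> w i \<le> w j)
            \<and> 1 \<le> B \<and> B \<le> n \<and> w 1 = w B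
            \<longrightarrow> T_gt n w B (nat \<lfloor>C * real n ^ 2 * ln (real n)\<rfloor>) \<le> C * real n powr (- c)"
  proof (intro exI[of _ "C * (c + 3)"] allI impI)
    fix n B and w :: "nat \<Rightarrow> real"
    assume H: "1 \<le> n \<and> 0 < w 1 \<and> (\<forall>i j. 1 \<le> i \<and> i \<le> j \<and> j \<le> n \<longrightarrow> w i \<le> w j)
            \<and> 1 \<le> B \<and> B \<le> n \<and> w 1 = w B"
    define M where "M = C * real n ^ 2"
    define t where "t = nat \<lfloor>C * (c + 3) * real n ^ 2 * ln (real n)\<rfloor>"
    have n: "1 \<le> real n" using H by simp
    have M: "1 \<le> M" using mult_mono[of 1 C 1 "real n ^ 2"] C n by (simp add: M_def)
    have ln: "0 \<le> ln (real n)" using n by simp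
    have eq: "(c + 3) * M * ln (real n) = C * (c + 3) * real n ^ 2 * ln (real n)"
      by (simp add: M_def mult_ac)
    have "(c + 3) * M * ln (real n) - 1 \<le> real t" unfolding t_def eq by linarith
    then have "- real t / M \<le> (1 - (c + 3) * M * ln (real n)) / M"
      using M by (intro divide_right_mono) auto
    also have "\<dots> = 1 / M - (c + 3) * ln (real n)" using M by (simp add: field_simps)
    also have "\<dots> \<le> 1 - (c + 2) * ln (real n)"
    proof -
      have "1 / M \<le> 1" using M by simp
      moreover have "(c + 3) * ln (real n) = (c + 2) * ln (real n) + ln (real n)"
        by (simp add: algebra_simps)
      ultimately show ?thesis using ln by linarith
    qed
    finally have "exp (- real t / M) \<le> exp (1 - (c + 2) * ln (real n))" by simp
    also have "\<dots> = exp 1 * real n powr (- c - 2)"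
      using n by (simp add: powr_def mult_exp_exp algebra_simps)
    also have "\<dots> \<le> 3 * real n powr (- c - 2)" using exp_le by (intro mult_right_mono) auto
    finally have "M * exp (- real t / M) \<le> M * (3 * real n powr (- c - 2))"
      using M by (intro mult_left_mono) auto
    also have "\<dots> = 3 * C * (real n powr 2 * real n powr (- c - 2))"
      using n by (simp add: M_def)
    also have "\<dots> = 3 * C * real n powr (- c)" unfolding powr_add[symmetric] by simp
    also have "\<dots> \<le> C * (c + 3) * real n powr (- c)" using C c by (intro mult_right_mono) auto
    finally show "T_gt n w B (nat \<lfloor>C * (c + 3) * real n ^ 2 * ln (real n)\<rfloor>) \<le> C * (c + 3) * real n powr (- c)"
      using bound[OF H] unfolding M_def t_def by (meson order_trans)
  qed
qed

end
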